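(* Let $q$ be a positive integer that is not a power of $2$, let $\pi$ be a permutation of $\{0,\dots,q-1\}$, and let $F_\pi:I\to I$ be the associated rotated odometer on $I=[0,1)$. Assume that $F_\pi$ is stationary, with substitution $\chi$ on the alphabet $\mathcal A$ (with doubled middle symbol if $q$ is odd) and associated matrix $M$, and that Lebesgue measure $\mathrm{Leb}$ is ergodic for $F_\pi$. Order the eigenvalues of $M$ by absolute value, $\lambda_0\ge|\lambda_1|\ge|\lambda_2|\ge\cdots$. Suppose that $M$ is diagonalizable, that the largest eigenvalue $\lambda_0$ has multiplicity $1$, and that the second largest eigenvalue satisfies $|\lambda_1|>1$. Then for the $\mathbb Z$-extension $T_\pi:I\times\mathbb Z\to I\times\mathbb Z$, $T_\pi(x,n)=(F_\pi(x),n+\psi(x))$, with skew-function $\psi=1$ on $[0,\tfrac12)$ and $\psi=-1$ on $[\tfrac12,1)$, the diffusion coefficients satisfy $$\gamma(x)\le\gamma_0:=\frac{\log|\lambda_1|}{\log\lambda_0}\qquad\text{for Leb-a.e. }x\in I.$$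
   Context: Rotated odometer. The von Neumann-Kakutani map $\mathfrak a:I\to I$, $I=[0,1)$, is $\mathfrak a(x)=x-(1-3\cdot 2^{-n})$ if $x\in[1-2^{1-n},1-2^{-n})$, $n\ge1$. For a permutation $\pi$ of $\{0,\dots,q-1\}$ put $R_\pi(x)=x+\frac{\pi(j)-j}{q}$ if $x\in[\frac jq,\frac{j+1}q)$. The rotated odometer is $F_\pi=\mathfrak a\circ R_\pi$; it preserves Lebesgue measure and is invertible except that $0$ has no preimage. Substitutions. Let $N=\min\{n\ge1:2^n\ge q\}$, $L_k=[0,2^{-kN})$ for $k\ge0$, and $L_{k,i}=[\frac{i}{q2^{kN}},\frac{i+1}{q2^{kN}})$ for $0\le i\le q-1$, so that the $L_{k,i}$ partition $L_k$. Let $F_{\pi,k}:L_k\to L_k$ be the first return map of $F_\pi$ to $L_k$ ($F_{\pi,0}=F_\pi$). It is known that for $k\ge1$ all points of $L_{k,i}$ have the same first return time $t_{k,i}$ to $L_k$ under $F_{\pi,k-1}$ and that, for $0\le j<t_{k,i}$, the set $F_{\pi,k-1}^j(L_{k,i})$ is an interval contained in a single $L_{k-1,w_j}$; define the word $\chi_k(i)=w_0w_1\cdots w_{t_{k,i}-1}$ over the alphabet $\{0,\dots,q-1\}$. This gives substitutions $\chi_k$, extended to words by concatenation. $F_\pi$ is called stationary if $\chi_k=\chi_1=:\chi$ for all $k\ge1$. Doubling the middle symbol. If $q$ is even, $\mathcal A=\{0,\dots,q-1\}$ and $\chi$ is unchanged. If $q$ is odd, let $m=(q-1)/2$; the letter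 $m$ is replaced by two letters $m^+$ (for the interval $[\frac mq,\frac12)$) and $m^-$ (for $[\frac12,\frac{m+1}q)$), giving the alphabet $\mathcal A=\{0,\dots,m-1,m^+,m^-,m+1,\dots,q-1\}$ with $q+1$ letters. The substitution, still called $\chi$, assigns to $a\in\mathcal A\setminus\{m^\pm\}$ the itinerary of $L_{1,a}$ under $F_\pi$ up to its first return to $L_1$ with respect to this refined partition of $I$, and to both $m^+$ and $m^-$ the itinerary of $L_{1,m}$ (these itineraries are well defined). The associated matrix $M$ is the $\mathcal A\times\mathcal A$ matrix whose $(a,b)$ entry is the number of letters $b$ in $\chi(a)$. Diffusion coefficient. With $\xi:I\times\mathbb Z\to\mathbb Z$, $\xi(x,k)=k$, the diffusion coefficient at $x\in I$ is $$\gamma(x)=\limsup_{n\to\infty}\frac{\log|\xi(T_\pi^n(x,k))-k|}{\log n},$$ which does not depend on $k\in\mathbb Z$ (convention $\log 0=-\infty$). *)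

theory Defs
  imports
    "HOL-Analysis.Analysis"
    "HOL-Combinatorics.Permutations"
    "Jordan_Normal_Form.Char_Poly"
begin

section \<open>The rotated odometer\<close>

text \<open>The interval \<open>I\<close> is \<open>{0..<1}\<close>. The maps below are total functions on \<^typ>\<open>real\<close>;
  only their values on \<open>I\<close> are meaningful.\<close>

definition kakutani :: "real \<Rightarrow> real" where
  "kakutani x =
     (let n = (THE n::nat. 1 \<le> n \<and> x \<in> {1 - 2 / 2 ^ n ..< 1 - 1 / 2 ^ n})
      in x - (1 - 3 / 2 ^ n))"

text \<open>For \<open>x\<close> in \<open>I\<close>, \<open>nat \<lfloor>q x\<rfloor>\<close> is the index \<open>j\<close> with \<open>x \<in> [j/q, (j+1)/q)\<close>.\<close>

definition rot :: "nat \<Rightarrow> (nat \<Rightarrow> nat) \<Rightarrow> real \<Rightarrow> real" where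
  "rot q \<pi> x =
     (let j = nat \<lfloor>real q * x\<rfloor> in x + (real (\<pi> j) - real j) / real q)"

definition rotated_odometer :: "nat \<Rightarrow> (nat \<Rightarrow> nat) \<Rightarrow> real \<Rightarrow> real" where
  "rotated_odometer q \<pi> = kakutani \<circ> rot q \<pi>"


section \<open>First return maps and the substitutions\<close>

definition first_return_time :: "('a \<Rightarrow> 'a) \<Rightarrow> 'a set \<Rightarrow> 'a \<Rightarrow> nat" where
  "first_return_time f A x = (LEAST n. 1 \<le> n \<and> (f ^^ n) x \<in> A)"

definition first_return_map :: "('a \<Rightarrow> 'a) \<Rightarrow> 'a set \<Rightarrow> 'a \<Rightarrow> 'a" where
  "first_return_map f A x = (f ^^ first_return_time f A x) x"

definition level_exp :: "nat \<Rightarrow> nat" where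
  "level_exp q = (LEAST n. 1 \<le> n \<and> q \<le> 2 ^ n)"

definition level :: "nat \<Rightarrow> nat \<Rightarrow> real set" where
  "level q k = {0 ..< 1 / 2 ^ (k * level_exp q)}"

definition sublevel :: "nat \<Rightarrow> nat \<Rightarrow> nat \<Rightarrow> real set" where
  "sublevel q k i =
     {real i / (real q * 2 ^ (k * level_exp q)) ..<
      (real i + 1) / (real q * 2 ^ (k * level_exp q))}"

definition return_map :: "nat \<Rightarrow> (nat \<Rightarrow> nat) \<Rightarrow> nat \<Rightarrow> real \<Rightarrow> real" where
  "return_map q \<pi> k =
     (if k = 0 then rotated_odometer q \<pi>
      else first_return_map (rotated_odometer q \<pi>) (level q k))"

text \<open>The common return time \<open>t\<^sub>k\<^sub>,\<^sub>i\<close> of the points of \<open>L\<^sub>k\<^sub>,\<^sub>i\<close> to \<open>L\<^sub>k\<close> under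
  \<open>F\<^sub>\<pi>\<^sub>,\<^sub>k\<^sub>-\<^sub>1\<close>, for \<open>k \<ge> 1\<close>.\<close>

definition return_time :: "nat \<Rightarrow> (nat \<Rightarrow> nat) \<Rightarrow> nat \<Rightarrow> nat \<Rightarrow> nat" where
  "return_time q \<pi> k i =
     (THE t. \<forall>x \<in> sublevel q k i.
        first_return_time (return_map q \<pi> (k - 1)) (level q k) x = t)"

text \<open>The itinerary of \<open>L\<^sub>k\<^sub>,\<^sub>i\<close> under \<open>F\<^sub>\<pi>\<^sub>,\<^sub>k\<^sub>-\<^sub>1\<close> up to its first return to \<open>L\<^sub>k\<close>, with respect
  to disjoint sets \<open>P 0, \<dots>, P (d - 1)\<close>. It is meaningful when each iterate of \<open>L\<^sub>k\<^sub>,\<^sub>i\<close> before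
  the return lies in a single one of these sets.\<close>

definition itinerary ::
  "nat \<Rightarrow> (nat \<Rightarrow> nat) \<Rightarrow> nat \<Rightarrow> nat \<Rightarrow> (nat \<Rightarrow> real set) \<Rightarrow> nat \<Rightarrow> nat list" where
  "itinerary q \<pi> k d P i =
     map (\<lambda>j. THE w. w < d \<and> (return_map q \<pi> (k - 1) ^^ j) ` sublevel q k i \<subseteq> P w)
       [0 ..< return_time q \<pi> k i]"

definition substitution :: "nat \<Rightarrow> (nat \<Rightarrow> nat) \<Rightarrow> nat \<Rightarrow> nat \<Rightarrow> nat list" where
  "substitution q \<pi> k i = itinerary q \<pi> k q (sublevel q (k - 1)) i"

definition stationary :: "nat \<Rightarrow> (nat \<Rightarrow> nat) \<Rightarrow> bool" where
  "stationary q \<pi> \<longleftrightarrow> (\<forall>k \<ge> 1. \<forall>i < q. substitution q \<pi> k i = substitution q \<pi> 1 i)"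


section \<open>Doubling the middle symbol\<close>

text \<open>The letters of \<open>\<A>\<close> are numbered from left to right. For odd \<open>q\<close>, with \<open>m = (q - 1)/2\<close>,
  this means that number \<open>m\<close> is the letter \<open>m\<^sup>+\<close>, number \<open>m + 1\<close> is \<open>m\<^sup>-\<close>, and number \<open>a > m + 1\<close>
  is the original letter \<open>a - 1\<close>. The function \<open>undouble\<close> gives the original letter, with
  \<open>m\<^sup>+\<close> and \<open>m\<^sup>-\<close> both mapped to \<open>m\<close>.\<close>

definition alphabet_size :: "nat \<Rightarrow> nat" where
  "alphabet_size q = (if even q then q else q + 1)"

definition undouble :: "nat \<Rightarrow> nat \<Rightarrow> nat" where
  "undouble q a = (if even q \<or> a \<le> (q - 1) div 2 then a else a - 1)"

definition letter_interval :: "nat \<Rightarrow> nat \<Rightarrow> real set" where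
  "letter_interval q a =
     (if odd q \<and> a = (q - 1) div 2 then sublevel q 0 (undouble q a) \<inter> {..< 1/2}
      else if odd q \<and> a = (q - 1) div 2 + 1 then sublevel q 0 (undouble q a) \<inter> {1/2 ..}
      else sublevel q 0 (undouble q a))"

definition doubled_subst :: "nat \<Rightarrow> (nat \<Rightarrow> nat) \<Rightarrow> nat \<Rightarrow> nat list" where
  "doubled_subst q \<pi> a =
     itinerary q \<pi> 1 (alphabet_size q) (letter_interval q) (undouble q a)"

definition subst_matrix :: "nat \<Rightarrow> (nat \<Rightarrow> nat) \<Rightarrow> complex mat" where
  "subst_matrix q \<pi> =
     Matrix.mat (alphabet_size q) (alphabet_size q)
       (\<lambda>(a, b). of_nat (count_list (doubled_subst q \<pi> a) b))"

definition diagonalizable :: "'a::semiring_1 mat \<Rightarrow> bool" where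
  "diagonalizable A \<longleftrightarrow> (\<exists>D. diagonal_mat D \<and> similar_mat A D)"


section \<open>Ergodicity\<close>

definition Leb :: "real measure" where
  "Leb = restrict_space lborel {0..<1}"

text \<open>Only the triviality of invariant sets is required; invariance of \<open>\<mu>\<close> under \<open>f\<close> is not
  part of the definition (a rotated odometer always preserves \<open>Leb\<close>).\<close>

definition ergodic :: "'a measure \<Rightarrow> ('a \<Rightarrow> 'a) \<Rightarrow> bool" where
  "ergodic \<mu> f \<longleftrightarrow>
     (\<forall>A \<in> sets \<mu>. f -` A \<inter> space \<mu> = A \<longrightarrow> emeasure \<mu> A = 0 \<or> emeasure \<mu> (space \<mu> - A) = 0)"


section \<open>The skew product and its diffusion coefficient\<close>

definition skew :: "real \<Rightarrow> int" where
  "skew x = (if x < 1/2 then 1 else -1)"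

definition extension :: "nat \<Rightarrow> (nat \<Rightarrow> nat) \<Rightarrow> real \<times> int \<Rightarrow> real \<times> int" where
  "extension q \<pi> = (\<lambda>(x, n). (rotated_odometer q \<pi> x, n + skew x))"

text \<open>The logarithm of a nonnegative real, with \<open>log 0 = -\<infinity>\<close>.\<close>

definition elog :: "real \<Rightarrow> ereal" where
  "elog r = (if r = 0 then -\<infinity> else ereal (ln r))"

definition diffusion_coeff :: "nat \<Rightarrow> (nat \<Rightarrow> nat) \<Rightarrow> int \<Rightarrow> real \<Rightarrow> ereal" where
  "diffusion_coeff q \<pi> k x =
     limsup (\<lambda>n. elog \<bar>real_of_int (snd ((extension q \<pi> ^^ n) (x, k)) - k)\<bar> / ereal (ln (real n)))"

end

theory Submission
  imports Defs "HOL-Library.Discrete_Functions" "HOL-Real_Asymp.Real_Asymp"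
begin

text \<open>
  Let \<open>g\<close> be the permutation of the \<open>q 2\<^sup>k\<^sup>N\<close> cells of length \<open>1 / (q 2\<^sup>k\<^sup>N)\<close> that agrees with
  \<open>F\<^sub>\<pi>\<close> except where the orbit enters \<open>L\<^sub>k\<close>. Ergodicity forces every cycle of \<open>g\<close> (for \<open>k = 1\<close>) to meet
  \<open>L\<^sub>1\<close>, so the vector of lengths of the letters is a positive left eigenvector of \<open>M\<close> with
  eigenvalue \<open>2\<^sup>N\<close>. Hence \<open>\<lambda>\<^sub>0 = 2\<^sup>N\<close>, and since the skew function \<open>\<psi>\<close> has mean zero it has no component
  along the top eigenvector: the sums of \<open>\<psi>\<close> over first returns to \<open>L\<^sub>k\<close> are \<open>O(|\<lambda>\<^sub>1|\<^sup>k)\<close>. By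
  stationarity a return to \<open>L\<^sub>k\<^sub>+\<^sub>1\<close> consists of boundedly many returns to \<open>L\<^sub>k\<close>, so an orbit segment
  that avoids \<open>L\<^sub>k\<close> splits into boundedly many returns to each \<open>L\<^sub>j\<close>, \<open>j < k\<close>, and its sum is
  \<open>O(|\<lambda>\<^sub>1|\<^sup>k)\<close>. The points that enter \<open>L\<^sub>k\<close> within \<open>n\<close> steps have measure at most
  \<open>(n + 1) 2\<^sup>-\<^sup>k\<^sup>N\<close>, so by Borel-Cantelli almost every orbit avoids \<open>L\<^sub>k\<close> up to time \<open>\<lambda>\<^sub>0\<^sup>s\<^sup>k\<close> for all large
  \<open>k\<close>, for any \<open>s < 1\<close>. Let \<open>s\<close> tend to \<open>1\<close>.
\<close>

section \<open>First returns\<close>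

definition returns :: "('a \<Rightarrow> 'a) \<Rightarrow> 'a set \<Rightarrow> 'a \<Rightarrow> bool" where
  "returns f A x \<longleftrightarrow> (\<exists>n\<ge>1. (f ^^ n) x \<in> A)"

lemma first_return_time:
  assumes "returns f A x"
  shows "1 \<le> first_return_time f A x" "(f ^^ first_return_time f A x) x \<in> A"
  using LeastI_ex[of "\<lambda>n. 1 \<le> n \<and> (f ^^ n) x \<in> A"] assms
  unfolding returns_def first_return_time_def by auto

lemma first_return_time_le:
  "1 \<le> n \<Longrightarrow> (f ^^ n) x \<in> A \<Longrightarrow> first_return_time f A x \<le> n"
  unfolding first_return_time_def by (intro Least_le) auto

lemma before_first_return:
  "1 \<le> n \<Longrightarrow> n < first_return_time f A x \<Longrightarrow> (f ^^ n) x \<notin> A"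
  using first_return_time_le[of n f x A] by linarith

lemma first_return_time_eqI:
  assumes "1 \<le> n" "(f ^^ n) x \<in> A" "\<And>m. 1 \<le> m \<Longrightarrow> m < n \<Longrightarrow> (f ^^ m) x \<notin> A"
  shows "first_return_time f A x = n"
  unfolding first_return_time_def 
  by (rule Least_equality) (use assms in \<open>auto simp flip: not_less\<close>)

lemma first_return_map_in: "returns f A x \<Longrightarrow> first_return_map f A x \<in> A"
  unfolding first_return_map_def by (rule first_return_time)

section \<open>Birkhoff sums and visit times\<close>

definition bsum :: "('a \<Rightarrow> 'a) \<Rightarrow> ('a \<Rightarrow> 'b::comm_monoid_add) \<Rightarrow> nat \<Rightarrow> 'a \<Rightarrow> 'b" where
  "bsum f \<phi> n x = (\<Sum>t<n. \<phi> ((f ^^ t) x))"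

lemma bsum_0 [simp]: "bsum f \<phi> 0 x = 0"
  by (simp add: bsum_def)

lemma bsum_Suc: "bsum f \<phi> (Suc n) x = bsum f \<phi> n x + \<phi> ((f ^^ n) x)"
  by (simp add: bsum_def)

lemma funpow_shift: "(f ^^ m) ((f ^^ n) x) = (f ^^ (n + m)) x"
  by (metis add.commute comp_apply funpow_add)

lemma bsum_add: "bsum f \<phi> (m + n) x = bsum f \<phi> m x + bsum f \<phi> n ((f ^^ m) x)"
  by (induction n) (simp_all add: bsum_Suc add.assoc funpow_shift)

abbreviation visit_time :: "('a \<Rightarrow> 'a) \<Rightarrow> 'a set \<Rightarrow> nat \<Rightarrow> 'a \<Rightarrow> nat" where
  "visit_time f A \<equiv> bsum (first_return_map f A) (first_return_time f A)"

lemma funpow_first_return_map: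
  "(first_return_map f A ^^ p) x = (f ^^ visit_time f A p x) x"
  by (induction p) (simp_all add: bsum_Suc first_return_map_def funpow_shift)

text \<open>Cutting the orbit at its visits to \<open>A\<close> turns a Birkhoff sum of
  \<open>f\<close> into a Birkhoff sum of the induced map. This is the source of the recursion
  between levels.\<close>

lemma bsum_visit_time:
  "bsum f \<phi> (visit_time f A p x) x =
     bsum (first_return_map f A) (\<lambda>y. bsum f \<phi> (first_return_time f A y) y) p x"
  by (induction p) (simp_all add: bsum_Suc bsum_add funpow_first_return_map)

lemma visit_time_mono: "p \<le> p' \<Longrightarrow> visit_time f A p x \<le> visit_time f A p' x"
  unfolding bsum_def by (rule sum_mono2) auto

lemma visit_time_less:
  assumes "p < p'" "returns f A ((first_return_map f A ^^ p) x)"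
  shows "visit_time f A p x < visit_time f A p' x"
proof -
  have "visit_time f A p x < visit_time f A (Suc p) x"
    using first_return_time(1)[OF assms(2)] by (simp add: bsum_Suc)
  also have "\<dots> \<le> visit_time f A p' x" using assms(1) by (intro visit_time_mono) simp
  finally show ?thesis .
qed

lemma visit_time_Suc:
  "visit_time f A (Suc p) x =
     first_return_time f A x + visit_time f A p (first_return_map f A x)"
  using bsum_add[of "first_return_map f A" "first_return_time f A" 1 p x] by (simp add: bsum_Suc)

text \<open>Strong induction on \<open>n\<close>: the first return occurs no later than
  \<open>n\<close>, and removing it leaves a shorter visit. Thus every visit is an iterate of the
  induced map, with no assumption on what the orbit does after time \<open>n\<close>.\<close>

lemma visit_time_surj:
  "(f ^^ n) x \<in> A \<Longrightarrow> 1 \<le> n \<Longrightarrow> \<exists>p\<ge>1. n = visit_time f A p x"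
proof (induction n arbitrary: x rule: less_induct)
  case (less n x)
  let ?r = "first_return_time f A x"
  have r: "returns f A x" using less.prems unfolding returns_def by auto
  have le: "?r \<le> n" using less.prems by (intro first_return_time_le) auto
  have eq: "(f ^^ (n - ?r)) (first_return_map f A x) = (f ^^ n) x"
    unfolding first_return_map_def funpow_shift using le by simp
  show ?case
  proof (cases "n = ?r")
    case True
    then show ?thesis by (intro exI[of _ 1]) (simp add: bsum_Suc)
  next
    case False
    have "\<exists>p\<ge>1. n - ?r = visit_time f A p (first_return_map f A x)"
      using less.IH[of "n - ?r" "first_return_map f A x"] less.prems eq le False
        first_return_time(1)[OF r] by auto
    then obtain p where "p \<ge> 1" "n - ?r = visit_time f A p (first_return_map f A x)" by blast
    then show ?thesis using le by (intro exI[of _ "Suc p"]) (simp add: visit_time_Suc)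
  qed
qed

text \<open>Inducing in stages: the first visit to \<open>B\<close> is also a visit to
  \<open>A\<close>, hence some iterate of the map induced on \<open>A\<close>. Monotonicity of visit
  times makes it the first such iterate in \<open>B\<close>.\<close>

lemma nested_return:
  assumes "returns f B x" "B \<subseteq> A"
  shows "returns (first_return_map f A) B x"
    and "first_return_time f B x =
      visit_time f A (first_return_time (first_return_map f A) B x) x"
proof -
  let ?g = "first_return_map f A" and ?n = "first_return_time f B x"
  have n: "1 \<le> ?n" "(f ^^ ?n) x \<in> B" using first_return_time[OF assms(1)] by auto
  then obtain p where p: "p \<ge> 1" "?n = visit_time f A p x"
    using visit_time_surj[of ?n f x A] assms(2) by auto
  have pB: "(?g ^^ p) x \<in> B" unfolding funpow_first_return_map using n p by simp
  then show r: "returns ?g B x" using p unfolding returns_def by auto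
  let ?T = "first_return_time ?g B x"
  have T: "1 \<le> ?T" "(?g ^^ ?T) x \<in> B" using first_return_time[OF r] by auto
  have "?T \<le> p" using p pB by (intro first_return_time_le)
  then have le: "visit_time f A ?T x \<le> ?n" using p visit_time_mono by metis
  have rA: "returns f A x" using assms unfolding returns_def by auto
  have "first_return_time f A x \<le> visit_time f A ?T x"
    using visit_time_mono[OF T(1), of f A x] by (simp add: bsum_Suc)
  then have "1 \<le> visit_time f A ?T x" using first_return_time(1)[OF rA] by linarith
  moreover have "(f ^^ visit_time f A ?T x) x \<in> B"
    using T(2) unfolding funpow_first_return_map .
  ultimately have "?n \<le> visit_time f A ?T x" by (rule first_return_time_le)
  then show "?n = visit_time f A ?T x" using le by simp
qed

text \<open>The coding \<open>c\<close> carries \<open>f\<close> to \<open>g\<close>, except that on arrival in \<open>B\<close> all information beyond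
  membership in \<open>B\<close> is lost.\<close>

definition tracks :: "('a \<Rightarrow> 'a) \<Rightarrow> ('b \<Rightarrow> 'b) \<Rightarrow> ('a \<Rightarrow> 'b) \<Rightarrow> 'b set \<Rightarrow> 'a set \<Rightarrow> bool" where
  "tracks f g c B X \<longleftrightarrow>
     (\<forall>x\<in>X. f x \<in> X \<and> (g (c x) \<in> B \<longrightarrow> c (f x) \<in> B) \<and> (g (c x) \<notin> B \<longrightarrow> c (f x) = g (c x)))"

lemma tracks_funpow_in: "tracks f g c B X \<Longrightarrow> x \<in> X \<Longrightarrow> (f ^^ n) x \<in> X"
  by (induction n) (auto simp: tracks_def)

lemma tracks_before:
  assumes "tracks f g c B X" "x \<in> X" "\<And>t. 1 \<le> t \<Longrightarrow> t \<le> n \<Longrightarrow> (g ^^ t) (c x) \<notin> B"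
  shows "c ((f ^^ n) x) = (g ^^ n) (c x)"
  using assms(3)
proof (induction n)
  case (Suc n)
  then have "c ((f ^^ n) x) = (g ^^ n) (c x)" by auto
  moreover have "(f ^^ n) x \<in> X" using assms tracks_funpow_in by metis
  ultimately show ?case using assms(1) Suc.prems[of "Suc n"] unfolding tracks_def by auto
qed simp

lemma tracks_at:
  assumes "tracks f g c B X" "x \<in> X" "\<And>t. 1 \<le> t \<Longrightarrow> t < n \<Longrightarrow> (g ^^ t) (c x) \<notin> B"
    and "1 \<le> n" "(g ^^ n) (c x) \<in> B"
  shows "c ((f ^^ n) x) \<in> B"
proof -
  obtain m where n: "n = Suc m" using assms(4) by (cases n) auto
  have "c ((f ^^ m) x) = (g ^^ m) (c x)" by (rule tracks_before[OF assms(1,2)]) (use assms(3) n in auto)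
  moreover have "(f ^^ m) x \<in> X" using assms tracks_funpow_in by metis
  ultimately show ?thesis using assms(1,5) n unfolding tracks_def by auto
qed

text \<open>Information is lost only on arrival in \<open>B\<close>, and since \<open>B\<close> lies
  in \<open>A\<close> such an arrival already ends the excursion.\<close>

lemma tracks_return:
  assumes "tracks f g c B X" "x \<in> X" "B \<subseteq> A" "returns g A (c x)"
  shows "first_return_time f {x \<in> X. c x \<in> A} x = first_return_time g A (c x)"
    and "returns f {x \<in> X. c x \<in> A} x"
proof -
  let ?n = "first_return_time g A (c x)"
  note n = first_return_time[OF assms(4)]
  have b: "(g ^^ t) (c x) \<notin> A" if "1 \<le> t" "t < ?n" for t
    using that before_first_return[of t g A "c x"] by auto
  then have bB: "(g ^^ t) (c x) \<notin> B" if "1 \<le> t" "t < ?n" for t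
    using that assms(3) by auto
  have at: "c ((f ^^ ?n) x) \<in> A"
  proof (cases "(g ^^ ?n) (c x) \<in> B")
    case True
    have "c ((f ^^ ?n) x) \<in> B"
      by (rule tracks_at[OF assms(1,2)]) (use bB n(1) True in auto)
    then show ?thesis using assms(3) by auto
  next
    case False
    have "c ((f ^^ ?n) x) = (g ^^ ?n) (c x)"
      by (rule tracks_before[OF assms(1,2)]) (use bB False in \<open>metis le_neq_implies_less\<close>)
    then show ?thesis using n(2) by simp
  qed
  then have at': "(f ^^ ?n) x \<in> {x \<in> X. c x \<in> A}"
    using tracks_funpow_in[OF assms(1,2)] by auto
  then show "returns f {x \<in> X. c x \<in> A} x" using n(1) unfolding returns_def by blast
  show "first_return_time f {x \<in> X. c x \<in> A} x = ?n"
  proof (rule first_return_time_eqI[OF n(1) at'])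
    fix m assume m: "1 \<le> m" "m < ?n"
    have "c ((f ^^ m) x) = (g ^^ m) (c x)"
      by (rule tracks_before[OF assms(1,2)]) (use bB m in auto)
    then show "(f ^^ m) x \<notin> {x \<in> X. c x \<in> A}" using b[OF m] by auto
  qed
qed

text \<open>An excursion from \<open>A\<close> can meet \<open>B\<close> only at its end, so passing
  to first returns keeps the coding exact away from the same set \<open>B\<close>.\<close>

lemma tracks_first_return_map:
  assumes "tracks f g c B X" "B \<subseteq> A" "\<And>x. x \<in> X \<Longrightarrow> c x \<in> A \<Longrightarrow> returns g A (c x)"
  shows "tracks (first_return_map f {x \<in> X. c x \<in> A}) (first_return_map g A) c B {x \<in> X. c x \<in> A}"
  unfolding tracks_def
proof (intro ballI)
  fix x assume "x \<in> {x \<in> X. c x \<in> A}"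
  then have x: "x \<in> X" "c x \<in> A" by auto
  note r = assms(3)[OF x]
  note n = tracks_return[OF assms(1) x(1) assms(2) r]
  let ?n = "first_return_time g A (c x)"
  have bB: "(g ^^ t) (c x) \<notin> B" if "1 \<le> t" "t < ?n" for t
    using that before_first_return[of t g A "c x"] assms(2) by auto
  have 1: "first_return_map f {x \<in> X. c x \<in> A} x \<in> {x \<in> X. c x \<in> A}"
    by (rule first_return_map_in[OF n(2)])
  have 2: "c ((f ^^ ?n) x) \<in> B" if "(g ^^ ?n) (c x) \<in> B"
    by (rule tracks_at[OF assms(1) x(1)]) (use bB first_return_time(1)[OF r] that in auto)
  have 3: "c ((f ^^ ?n) x) = (g ^^ ?n) (c x)" if "(g ^^ ?n) (c x) \<notin> B"
    by (rule tracks_before[OF assms(1) x(1)]) (use bB that in \<open>metis le_neq_implies_less\<close>)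
  show "first_return_map f {x \<in> X. c x \<in> A} x \<in> {x \<in> X. c x \<in> A} \<and>
      (first_return_map g A (c x) \<in> B \<longrightarrow> c (first_return_map f {x \<in> X. c x \<in> A} x) \<in> B) \<and>
      (first_return_map g A (c x) \<notin> B \<longrightarrow>
        c (first_return_map f {x \<in> X. c x \<in> A} x) = first_return_map g A (c x))"
    using 1 2 3 unfolding first_return_map_def n(1) by blast
qed

section \<open>Return towers of an injection of a finite set\<close>

lemma funpow_in: "g ` S \<subseteq> S \<Longrightarrow> x \<in> S \<Longrightarrow> (g ^^ n) x \<in> S"
  by (induction n) auto

lemma funpow_cancel:
  assumes "inj_on g S" "g ` S \<subseteq> S" "x \<in> S" "y \<in> S" "(g ^^ n) x = (g ^^ n) y"
  shows "x = y"
  using assms(5)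
proof (induction n)
  case (Suc n)
  then have "(g ^^ n) x = (g ^^ n) y"
    using inj_onD[OF assms(1)] funpow_in[OF assms(2)] assms(3,4) by simp
  then show ?case by (rule Suc.IH)
qed simp

text \<open>Pigeonhole gives two equal iterates, and injectivity cancels the common initial
  steps.\<close>

lemma funpow_recurrent:
  assumes "finite S" "inj_on g S" "g ` S \<subseteq> S" "x \<in> S"
  shows "\<exists>n\<ge>1. (g ^^ n) x = x"
proof -
  have "\<not> inj (\<lambda>n. (g ^^ n) x)"
  proof
    assume "inj (\<lambda>n. (g ^^ n) x)"
    moreover have "range (\<lambda>n. (g ^^ n) x) \<subseteq> S" using funpow_in[OF assms(3,4)] by auto
    ultimately show False using assms(1) finite_subset infinite_UNIV_nat finite_imageD by metis
  qed
  then obtain a b where "a \<noteq> b" "(g ^^ a) x = (g ^^ b) x" unfolding inj_def by auto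
  then obtain m n where mn: "m < n" "(g ^^ m) x = (g ^^ n) x"
    by (metis linorder_neqE_nat)
  have "(g ^^ m) x = (g ^^ m) ((g ^^ (n - m)) x)" using mn by (simp add: funpow_shift)
  then have "x = (g ^^ (n - m)) x"
    using funpow_cancel[OF assms(2,3,4) funpow_in[OF assms(3,4)]] by blast
  then show ?thesis using mn by (intro exI[of _ "n - m"]) auto
qed

lemma returns_finite:
  assumes "finite S" "inj_on g S" "g ` S \<subseteq> S" "A \<subseteq> S" "x \<in> A"
  shows "returns g A x"
  using funpow_recurrent[OF assms(1-3), of x] assms(4,5) unfolding returns_def by fastforce

text \<open>Cancelling \<open>g ^^ m\<close> puts \<open>a\<close> on the orbit of \<open>b\<close>
  at time \<open>n - m\<close>, before \<open>b\<close> returns to \<open>A\<close>; so this time is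
  0.\<close>

lemma tower_unique:
  assumes "inj_on g S" "g ` S \<subseteq> S" "A \<subseteq> S" "a \<in> A" "b \<in> A" "m \<le> n"
    and "n - m < first_return_time g A b" "(g ^^ m) a = (g ^^ n) b"
  shows "m = n \<and> a = b"
proof -
  have "(g ^^ m) a = (g ^^ m) ((g ^^ (n - m)) b)" using assms by (simp add: funpow_shift)
  then have a: "a = (g ^^ (n - m)) b"
    using funpow_cancel[OF assms(1,2)] funpow_in[OF assms(2)] assms(3-5) by (metis subsetD)
  then have "\<not> 1 \<le> n - m" using before_first_return[of "n - m" g A b] assms(4,7) by auto
  then show ?thesis using a assms(6) by simp
qed

lemma first_return_map_inj:
  assumes "finite S" "inj_on g S" "g ` S \<subseteq> S" "A \<subseteq> S"
  shows "inj_on (first_return_map g A) A" "first_return_map g A ` A \<subseteq> A"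
proof -
  note r = returns_finite[OF assms]
  show "first_return_map g A ` A \<subseteq> A" using first_return_map_in[OF r] by auto
  have *: "a = b" if ab: "a \<in> A" "b \<in> A" "first_return_time g A a \<le> first_return_time g A b"
      "first_return_map g A a = first_return_map g A b" for a b
  proof -
    have "first_return_time g A b - first_return_time g A a < first_return_time g A b"
      using first_return_time(1)[OF r[OF ab(1)]] ab(3) by linarith
    then show ?thesis
      using tower_unique[OF assms(2-4) ab(1-3)] ab(4) unfolding first_return_map_def by blast
  qed
  show "inj_on (first_return_map g A) A"
    by (rule inj_onI) (metis * nle_le)
qed

text \<open>Index set of the Kakutani-Rokhlin tower over \<open>B\<close>: the pair
  \<open>(i, j)\<close> stands for the \<open>j\<close>-th floor above \<open>i\<close>.\<close>

definition tower :: "('a \<Rightarrow> 'a) \<Rightarrow> 'a set \<Rightarrow> ('a \<times> nat) set" where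
  "tower g B = (SIGMA i:B. {..<first_return_time g B i})"

lemma inj_on_tower:
  assumes "inj_on g S" "g ` S \<subseteq> S" "B \<subseteq> S"
  shows "inj_on (\<lambda>(i, j). (g ^^ j) i) (tower g B)"
proof (rule inj_onI, clarify)
  have *: "m = n \<and> a = b" if "a \<in> B" "b \<in> B" "n < first_return_time g B b" "m \<le> n"
    "(g ^^ m) a = (g ^^ n) b" for a b m n
    using tower_unique[OF assms that(1,2,4) _ that(5)] that(3) by linarith
  fix a m b n assume h: "(a, m) \<in> tower g B" "(b, n) \<in> tower g B" "(g ^^ m) a = (g ^^ n) b"
  then have "a \<in> B" "b \<in> B" "m < first_return_time g B a" "n < first_return_time g B b"
    unfolding tower_def by simp_all
  then show "a = b \<and> m = n" using *[of a b n m] *[of b a m n] h(3) by (metis nle_le)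
qed

section \<open>The action on cells\<close>

definition cell :: "nat \<Rightarrow> real \<Rightarrow> nat" where
  "cell Q x = nat \<lfloor>real Q * x\<rfloor>"

lemma cell_eq_iff:
  assumes "0 < Q" "0 \<le> x"
  shows "cell Q x = c \<longleftrightarrow> real c \<le> real Q * x \<and> real Q * x < real c + 1"
proof -
  have "0 \<le> real Q * x" using assms by simp
  then show ?thesis unfolding cell_def by (simp add: nat_eq_iff floor_eq_iff)
qed

lemma cell_less_iff:
  assumes "0 \<le> x"
  shows "cell Q x < c \<longleftrightarrow> real Q * x < real c"
proof -
  have "0 \<le> real Q * x" using assms by simp
  then show ?thesis unfolding cell_def by (simp add: nat_less_iff floor_less_iff)
qed

lemma cell_less: "0 < Q \<Longrightarrow> x \<in> {0..<1} \<Longrightarrow> cell Q x < Q"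
  by (simp add: cell_less_iff)

lemma cell_div:
  assumes "0 \<le> x" "0 < M"
  shows "cell (Q * M) x div M = cell Q x"
proof -
  have "\<lfloor>(real (Q * M) * x) / real_of_int (int M)\<rfloor> = \<lfloor>real (Q * M) * x\<rfloor> div int M"
    by (rule floor_divide_real_eq_div) simp
  then have "\<lfloor>real Q * x\<rfloor> = \<lfloor>real (Q * M) * x\<rfloor> div int M" using assms by (simp add: field_simps)
  then show ?thesis unfolding cell_def using assms by (simp add: nat_div_distrib)
qed

lemma cell_shift:
  assumes "0 \<le> x" "0 \<le> y" "real Q * y = real Q * x + of_int z"
  shows "int (cell Q y) = int (cell Q x) + z"
proof -
  have "0 \<le> real Q * x" "0 \<le> real Q * y" using assms(1,2) by simp_all
  moreover from this have "0 \<le> \<lfloor>real Q * x\<rfloor>" "0 \<le> \<lfloor>real Q * y\<rfloor>" by simp_all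
  moreover have "\<lfloor>real Q * y\<rfloor> = \<lfloor>real Q * x\<rfloor> + z" using assms(3) by simp
  ultimately show ?thesis unfolding cell_def by (simp only: int_nat_eq if_True)
qed

text \<open>On the cells of length \<open>1 / (q 2\<^sup>K)\<close> the von Neumann-Kakutani map is the flip \<open>x \<mapsto> 1 - x\<close>
  followed by the flips of the blocks \<open>[2\<^sup>-\<^sup>n, 2\<^sup>1\<^sup>-\<^sup>n)\<close>, \<open>n \<le> K\<close>. The cells of the last block
  \<open>[1 - 2\<^sup>-\<^sup>K, 1)\<close> are sent into \<open>[0, 2\<^sup>-\<^sup>K)\<close> but not to cells, so there any bijection will do; the
  choice \<open>q - 1 - d\<close> makes \<open>block_flip\<close> an involution.\<close>

definition block_flip :: "nat \<Rightarrow> nat \<Rightarrow> nat" where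
  "block_flip q d =
     (if d < q then q - 1 - d else 3 * (q * 2 ^ floor_log (d div q)) - 1 - d)"

definition cell_rot :: "nat \<Rightarrow> (nat \<Rightarrow> nat) \<Rightarrow> nat \<Rightarrow> nat \<Rightarrow> nat" where
  "cell_rot q \<pi> K c = \<pi> (c div 2 ^ K) * 2 ^ K + c mod 2 ^ K"

definition cell_map :: "nat \<Rightarrow> (nat \<Rightarrow> nat) \<Rightarrow> nat \<Rightarrow> nat \<Rightarrow> nat" where
  "cell_map q \<pi> K c = block_flip q (q * 2 ^ K - 1 - cell_rot q \<pi> K c)"

lemma floor_log_block:
  assumes "q * 2 ^ m \<le> d" "d < 2 * (q * 2 ^ m)"
  shows "floor_log (d div q) = m"
proof -
  have q: "0 < q" using assms by (cases q) auto
  have "2 ^ m \<le> d div q" using assms q by (simp add: less_eq_div_iff_mult_less_eq mult.commute)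
  moreover have "d div q < 2 * 2 ^ m" using assms q by (simp add: div_less_iff_less_mult ac_simps)
  ultimately have "2 ^ m \<le> d div q" "d div q < 2 ^ Suc m" by simp_all
  moreover have pos: "0 < d div q" using \<open>2 ^ m \<le> d div q\<close> by (metis less_le_trans pos2 zero_less_power)
  moreover have "2 ^ floor_log (d div q) \<le> d div q" by (rule floor_log_exp2_le[OF pos])
  moreover have "d div q < 2 ^ Suc (floor_log (d div q))" using floor_log_exp2_gt[of "d div q"] by simp
  ultimately have "(2::nat) ^ m < 2 ^ Suc (floor_log (d div q))"
    "(2::nat) ^ floor_log (d div q) < 2 ^ Suc m" by linarith+
  then show ?thesis by (meson less_Suc_eq_le nle_le power_less_imp_less_exp one_less_numeral_iff semiring_norm(76))
qed

lemma block_exists: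
  fixes q d :: nat
  assumes "0 < q" "q \<le> d"
  shows "\<exists>m. q * 2 ^ m \<le> d \<and> d < 2 * (q * 2 ^ m)"
proof -
  have pos: "0 < d div q" using assms by (simp add: div_greater_zero_iff)
  have "2 ^ floor_log (d div q) \<le> d div q" by (rule floor_log_exp2_le[OF pos])
  then have 1: "q * 2 ^ floor_log (d div q) \<le> d"
    using assms by (simp add: less_eq_div_iff_mult_less_eq mult.commute)
  have "d div q < 2 * 2 ^ floor_log (d div q)" using floor_log_exp2_gt[of "d div q"] by simp
  then have 2: "d < 2 * (q * 2 ^ floor_log (d div q))"
    using assms by (simp add: div_less_iff_less_mult ac_simps)
  from 1 2 show ?thesis by blast
qed

lemma block_flip_high:
  assumes "q * 2 ^ m \<le> d" "d < 2 * (q * 2 ^ m)"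
  shows "block_flip q d = 3 * (q * 2 ^ m) - 1 - d"
proof -
  have "q * 1 \<le> q * 2 ^ m" by (intro mult_left_mono) simp_all
  then have "\<not> d < q" using assms by linarith
  then show ?thesis unfolding block_flip_def floor_log_block[OF assms] by simp
qed

lemma block_flip_block:
  assumes "q * 2 ^ m \<le> d" "d < 2 * (q * 2 ^ m)"
  shows "q * 2 ^ m \<le> block_flip q d" "block_flip q d < 2 * (q * 2 ^ m)"
  using assms unfolding block_flip_high[OF assms] by linarith+

lemma block_flip_flip: "0 < q \<Longrightarrow> block_flip q (block_flip q d) = d"
proof (cases "d < q")
  case True
  then show ?thesis by (simp add: block_flip_def)
next
  assume q: "0 < q" case False
  then obtain m where m: "q * 2 ^ m \<le> d" "d < 2 * (q * 2 ^ m)" using block_exists[OF q, of d] by auto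
  show ?thesis unfolding block_flip_high[OF block_flip_block[OF m]]
    unfolding block_flip_high[OF m] using m by linarith
qed

lemma block_flip_less_iff: "0 < q \<Longrightarrow> block_flip q d < q \<longleftrightarrow> d < q"
proof -
  assume q: "0 < q"
  have *: "q \<le> block_flip q d" if d: "q \<le> d" for d
  proof -
    obtain m where m: "q * 2 ^ m \<le> d" "d < 2 * (q * 2 ^ m)" using block_exists[OF q d] by auto
    have "q * 1 \<le> q * 2 ^ m" by (intro mult_left_mono) simp_all
    then show ?thesis using block_flip_block(1)[OF m] by linarith
  qed
  show ?thesis
  proof (cases "d < q")
    case True
    then show ?thesis by (simp add: block_flip_def)
  next
    case False
    then show ?thesis using *[of d] by simp
  qed
qed

lemma block_flip_bound:
  assumes "0 < q" "d < q * 2 ^ K"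
  shows "block_flip q d < q * 2 ^ K"
proof (cases "d < q")
  case True
  have "q * 1 \<le> q * 2 ^ K" by (intro mult_left_mono) simp_all
  then show ?thesis using block_flip_less_iff[OF assms(1), of d] True by linarith
next
  case False
  then obtain m where m: "q * 2 ^ m \<le> d" "d < 2 * (q * 2 ^ m)" using block_exists[OF assms(1), of d] by auto
  have "q * 2 ^ m < q * 2 ^ K" using m assms(2) by linarith
  then have "m < K" using assms(1) by simp
  then have "q * 2 ^ Suc m \<le> q * 2 ^ K" by (intro mult_left_mono power_increasing) auto
  then show ?thesis using block_flip_block(2)[OF m] by (simp only: power_Suc mult.left_commute[of q])
qed

section \<open>The rotated odometer as a permutation of cells\<close>

locale odometer =
  fixes q :: nat and \<pi> :: "nat \<Rightarrow> nat"
  assumes q: "q > 0" and perm: "\<pi> permutes {0..<q}"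
begin

lemma perm_less: "j < q \<Longrightarrow> \<pi> j < q"
  using permutes_in_image[OF perm, of j] by simp

lemma cell_rot_less:
  assumes "c < q * 2 ^ K"
  shows "cell_rot q \<pi> K c < q * 2 ^ K"
proof -
  have "c div 2 ^ K < q" using assms by (simp add: div_less_iff_less_mult)
  then have "Suc (\<pi> (c div 2 ^ K)) * 2 ^ K \<le> q * 2 ^ K"
    using perm_less by (intro mult_right_mono) (auto simp: Suc_le_eq)
  moreover have "c mod 2 ^ K < 2 ^ K" by simp
  ultimately show ?thesis unfolding cell_rot_def by (simp only: mult_Suc)
qed

lemma cell_rot_inj: "inj (cell_rot q \<pi> K)"
proof (rule injI)
  fix c d assume h: "cell_rot q \<pi> K c = cell_rot q \<pi> K d"
  have "cell_rot q \<pi> K e div 2 ^ K = \<pi> (e div 2 ^ K)" "cell_rot q \<pi> K e mod 2 ^ K = e mod 2 ^ K" for e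
    unfolding cell_rot_def by simp_all
  then have "\<pi> (c div 2 ^ K) = \<pi> (d div 2 ^ K)" "c mod 2 ^ K = d mod 2 ^ K" using h by metis+
  then have "c div 2 ^ K = d div 2 ^ K" "c mod 2 ^ K = d mod 2 ^ K"
    using permutes_inj[OF perm] by (auto dest: injD)
  then show "c = d" by (metis div_mult_mod_eq)
qed

lemma cell_map_image: "cell_map q \<pi> K ` {..<q * 2 ^ K} \<subseteq> {..<q * 2 ^ K}"
proof
  fix y assume "y \<in> cell_map q \<pi> K ` {..<q * 2 ^ K}"
  then obtain c where c: "c < q * 2 ^ K" "y = cell_map q \<pi> K c" by auto
  have "q * 2 ^ K - 1 - cell_rot q \<pi> K c < q * 2 ^ K" using c(1) by linarith
  then show "y \<in> {..<q * 2 ^ K}" unfolding c(2) cell_map_def using block_flip_bound[OF q] by simp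
qed

lemma cell_map_inj: "inj_on (cell_map q \<pi> K) {..<q * 2 ^ K}"
proof (rule inj_onI)
  fix c d assume cd: "c \<in> {..<q * 2 ^ K}" "d \<in> {..<q * 2 ^ K}" "cell_map q \<pi> K c = cell_map q \<pi> K d"
  then have "q * 2 ^ K - 1 - cell_rot q \<pi> K c = q * 2 ^ K - 1 - cell_rot q \<pi> K d"
    unfolding cell_map_def using block_flip_flip[OF q] by metis
  moreover have "cell_rot q \<pi> K c < q * 2 ^ K" "cell_rot q \<pi> K d < q * 2 ^ K"
    using cell_rot_less cd by auto
  ultimately have "cell_rot q \<pi> K c = cell_rot q \<pi> K d" by linarith
  then show "c = d" using cell_rot_inj by (auto dest: injD)
qed

lemma rot_cell:
  assumes x: "x \<in> {0..<1}"
  shows "rot q \<pi> x \<in> {0..<1}"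
    and "cell (q * 2 ^ K) (rot q \<pi> x) = cell_rot q \<pi> K (cell (q * 2 ^ K) x)"
proof -
  let ?j = "cell q x"
  have rot: "rot q \<pi> x = x + (real (\<pi> ?j) - real ?j) / real q"
    unfolding rot_def cell_def Let_def by simp
  have j: "?j < q" using cell_less[OF q x] .
  have jx: "real ?j \<le> real q * x" "real q * x < real ?j + 1"
    using cell_eq_iff[OF q, of x ?j] x by auto
  have qrot: "real q * rot q \<pi> x = real q * x + (real (\<pi> ?j) - real ?j)"
    unfolding rot using q by (simp add: field_simps)
  have p: "\<pi> ?j + 1 \<le> q" using perm_less[OF j] by simp
  have "0 \<le> real q * rot q \<pi> x" using qrot jx by linarith
  then have 1: "0 \<le> rot q \<pi> x" using q by (simp add: zero_le_mult_iff)
  have "real q * rot q \<pi> x < real (\<pi> ?j + 1)" using qrot jx by simp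
  also have "\<dots> \<le> real q * 1" using p by (simp only: of_nat_le_iff mult_1_right)
  finally have 2: "rot q \<pi> x < 1" using q by (simp only: mult_less_cancel_left_pos of_nat_0_less_iff)
  show r: "rot q \<pi> x \<in> {0..<1}" using 1 2 by simp
  let ?Q = "q * 2 ^ K" let ?c = "cell ?Q x"
  have cj: "?c div 2 ^ K = ?j" using cell_div[of x "2 ^ K" q] x by simp
  have "real ?Q * rot q \<pi> x = 2 ^ K * (real q * rot q \<pi> x)" by simp
  also have "\<dots> = real ?Q * x + of_int ((int (\<pi> ?j) - int ?j) * 2 ^ K)"
    unfolding qrot by (simp add: algebra_simps)
  finally have "int (cell ?Q (rot q \<pi> x)) = int ?c + (int (\<pi> ?j) - int ?j) * 2 ^ K"
    using cell_shift[of x "rot q \<pi> x" ?Q] x 1 by auto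
  moreover have "?j * 2 ^ K + ?c mod 2 ^ K = ?c" unfolding cj[symmetric] by (rule div_mult_mod_eq)
  then have "int (?j * 2 ^ K + ?c mod 2 ^ K) = int ?c" by (rule arg_cong)
  then have "int ?c = int ?j * 2 ^ K + int (?c mod 2 ^ K)"
    by (simp only: of_nat_add of_nat_mult of_nat_power of_nat_numeral)
  ultimately have "int (cell ?Q (rot q \<pi> x)) = int (cell_rot q \<pi> K ?c)"
    unfolding cell_rot_def cj by (simp add: algebra_simps)
  then show "cell ?Q (rot q \<pi> x) = cell_rot q \<pi> K ?c" by simp
qed

text \<open>Replaces the definite description by a concrete block. The index is the least
  \<open>n\<close> with \<open>1 / 2 ^ n < 1 - y\<close>; minimality gives the other bound of the
  block, and monotonicity of the powers of 2 gives uniqueness.\<close>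

lemma kakutani_eq:
  assumes y: "y \<in> {0..<1}"
  obtains n where "1 \<le> n" "1 - 2 / 2 ^ n \<le> y" "y < 1 - 1 / 2 ^ n" "kakutani y = y - (1 - 3 / 2 ^ n)"
proof -
  have z: "0 < 1 - y" "1 - y \<le> 1" using y by auto
  have "\<exists>n::nat. (1/2) ^ n < 1 - y" using real_arch_pow_inv[of "1 - y" "1/2"] z by auto
  then have ex: "\<exists>n::nat. 1 / 2 ^ n < 1 - y" by (simp add: power_one_over)
  define n where "n = (LEAST n::nat. 1 / 2 ^ n < 1 - y)"
  have n: "1 / 2 ^ n < 1 - y" unfolding n_def by (rule LeastI_ex[OF ex])
  have n1: "1 \<le> n" using n z by (cases n) auto
  have "\<not> 1 / 2 ^ (n - 1) < 1 - y" using not_less_Least[of "n - 1" "\<lambda>n. 1 / 2 ^ n < 1 - y"] n1 unfolding n_def by fastforce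
  then have n2: "1 - y \<le> 2 / 2 ^ n" using n1 by (cases n) auto
  have uniq: "m = n" if m: "1 \<le> m" "y \<in> {1 - 2 / 2 ^ m ..< 1 - 1 / 2 ^ m}" for m
  proof -
    have *: "a \<le> b" if "1 / 2 ^ a \<ge> (1 - y) / 2" "1 / 2 ^ b < 1 - y" for a b :: nat
    proof (rule ccontr)
      assume "\<not> a \<le> b"
      then have "(2::real) ^ Suc b \<le> 2 ^ a" by (intro power_increasing) auto
      then have "(1::real) / 2 ^ a \<le> 1 / 2 ^ Suc b" by (intro divide_left_mono) auto
      also have "(1::real) / 2 ^ Suc b = (1 / 2 ^ b) / 2" by simp
      also have "\<dots> < (1 - y) / 2" using that(2) by (rule divide_strict_right_mono) simp
      finally show False using that(1) by simp
    qed
    show ?thesis using *[of m n] *[of n m] m n n2 by auto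
  qed
  have "(THE n::nat. 1 \<le> n \<and> y \<in> {1 - 2 / 2 ^ n ..< 1 - 1 / 2 ^ n}) = n"
  proof (rule the_equality)
    show "1 \<le> n \<and> y \<in> {1 - 2 / 2 ^ n ..< 1 - 1 / 2 ^ n}" using n n1 n2 by simp
  qed (use uniq in blast)
  then have "kakutani y = y - (1 - 3 / 2 ^ n)" unfolding kakutani_def Let_def by simp
  moreover have "1 - 2 / 2 ^ n \<le> y" "y < 1 - 1 / 2 ^ n" using n n2 by linarith+
  ultimately show ?thesis using that n1 by blast
qed

text \<open>On a block with \<open>n \<le> K\<close> the map translates by a whole number of cells.
  The blocks with \<open>n > K\<close> fill exactly the last \<open>q\<close> cells and land in
  \<open>[0, 2^-K)\<close>, the first \<open>q\<close> cells, where only membership is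
  recorded.\<close>

lemma kakutani_cell:
  fixes K :: nat
  assumes y: "y \<in> {0..<1}"
  defines "Q \<equiv> q * 2 ^ K"
  shows "kakutani y \<in> {0..<1}"
    and "Q - 1 - cell Q y < q \<Longrightarrow> cell Q (kakutani y) < q"
    and "q \<le> Q - 1 - cell Q y \<Longrightarrow> cell Q (kakutani y) = block_flip q (Q - 1 - cell Q y)"
proof -
  obtain n where n: "1 \<le> n" "1 - 2 / 2 ^ n \<le> y" "y < 1 - 1 / 2 ^ n"
    and k: "kakutani y = y - (1 - 3 / 2 ^ n)" using kakutani_eq[OF y] .
  have Q: "0 < Q" unfolding Q_def using q by simp
  have k1: "1 / 2 ^ n \<le> kakutani y" "kakutani y < 2 / 2 ^ n" using n(2,3) unfolding k diff_divide_distrib by (simp_all add: diff_divide_distrib)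
  have "(2::real) ^ 1 \<le> 2 ^ n" using n(1) by (intro power_increasing) auto
  then have "2 / 2 ^ n \<le> (1::real)" by (simp add: field_simps)
  moreover have "0 < 1 / (2::real) ^ n" by simp
  ultimately have k01: "0 \<le> kakutani y" "kakutani y < 1" using k1 by linarith+
  then show "kakutani y \<in> {0..<1}" by simp
  have c: "cell Q y < Q" using cell_less[OF Q y] .
  let ?d = "Q - 1 - cell Q y"
  have cc: "real (cell Q y) \<le> real Q * y" "real Q * y < real (cell Q y) + 1"
    using cell_eq_iff[OF Q, of y "cell Q y"] y by auto
  have d: "real ?d + real (cell Q y) + 1 = real Q" using c by linarith
  show "cell Q (kakutani y) < q" if "?d < q"
  proof (cases "n \<le> K")
    case True
    have "q * 2 ^ (K - n) * 2 ^ n = Q" unfolding Q_def using True by (simp add: power_add[symmetric])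
    then have Qn: "real Q = real (q * 2 ^ (K - n)) * 2 ^ n" by (metis of_nat_mult of_nat_numeral of_nat_power)
    have "real Q * y < real Q * (1 - 1 / 2 ^ n)" using n(3) Q by (intro mult_strict_left_mono) auto
    also have "\<dots> = real Q - real (q * 2 ^ (K - n))" unfolding Qn by (simp add: field_simps)
    finally have "real Q * y < real Q - real (q * 2 ^ (K - n))" .
    moreover have "q * 1 \<le> q * 2 ^ (K - n)" by (intro mult_left_mono) simp_all
    then have "real q \<le> real (q * 2 ^ (K - n))" by (simp only: of_nat_le_iff mult_1_right)
    moreover have "real ?d + 1 \<le> real q" using that by linarith
    ultimately have False using cc(1) d by linarith
    then show ?thesis ..
  next
    case False
    then have "(2::real) ^ Suc K \<le> 2 ^ n" by (intro power_increasing) auto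
    then have "2 / 2 ^ n \<le> 1 / (2::real) ^ K" by (simp add: field_simps)
    then have "kakutani y < 1 / 2 ^ K" using k1 by linarith
    then have "real Q * kakutani y < real Q * (1 / 2 ^ K)" using Q by (intro mult_strict_left_mono) auto
    also have "\<dots> = real q" unfolding Q_def by simp
    finally show ?thesis using cell_less_iff[of "kakutani y" Q q] k01 by simp
  qed
  show "cell Q (kakutani y) = block_flip q ?d" if dq: "q \<le> ?d"
  proof (cases "n \<le> K")
    case True
    let ?B = "q * 2 ^ (K - n)"
    have "?B * 2 ^ n = Q" unfolding Q_def using True by (simp add: power_add[symmetric])
    then have Qn: "real Q = real ?B * 2 ^ n" by (metis of_nat_mult of_nat_numeral of_nat_power)
    have "real Q * y < real Q * (1 - 1 / 2 ^ n)" using n(3) Q by (intro mult_strict_left_mono) auto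
    also have "\<dots> = real Q - real ?B" unfolding Qn by (simp add: field_simps)
    finally have 1: "real Q * y < real Q - real ?B" .
    have "real Q * (1 - 2 / 2 ^ n) \<le> real Q * y" using n(2) Q by (intro mult_left_mono) auto
    moreover have "real Q * (1 - 2 / 2 ^ n) = real Q - 2 * real ?B" unfolding Qn by (simp add: field_simps)
    ultimately have 2: "real Q - 2 * real ?B \<le> real Q * y" by simp
    have "real (cell Q y) + real ?B < real Q" using 1 cc(1) by linarith
    then have "cell Q y + ?B < Q" by (simp only: of_nat_add[symmetric] of_nat_less_iff)
    then have b1: "?B \<le> ?d" by linarith
    have "real Q < real (cell Q y) + 1 + 2 * real ?B" using 2 cc(2) by linarith
    also have "\<dots> = real (cell Q y + 1 + 2 * ?B)" by simp
    finally have "Q < cell Q y + 1 + 2 * ?B" by (simp only: of_nat_less_iff)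
    then have b2: "?d < 2 * ?B" using c by linarith
    have "real Q * kakutani y = real Q * y + of_int (3 * int ?B - int Q)"
      unfolding k using Qn by (simp add: field_simps)
    then have "int (cell Q (kakutani y)) = int (cell Q y) + (3 * int ?B - int Q)"
      using cell_shift[of y "kakutani y" Q] y k01 by auto
    then show ?thesis unfolding block_flip_high[OF b1 b2] using c b2 by linarith
  next
    case False
    then have "(2::real) ^ Suc K \<le> 2 ^ n" by (intro power_increasing) auto
    then have "2 / 2 ^ n \<le> 1 / (2::real) ^ K" by (simp add: field_simps)
    then have "1 - 1 / 2 ^ K \<le> y" using n(2) by linarith
    then have "real Q * (1 - 1 / 2 ^ K) \<le> real Q * y" using Q by (intro mult_left_mono) auto
    moreover have "real Q * (1 - 1 / 2 ^ K) = real Q - real q" unfolding Q_def by (simp add: field_simps)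
    moreover have "real q \<le> real ?d" using dq by simp
    ultimately have False using cc(2) d by linarith
    then show ?thesis ..
  qed
qed

lemma rotated_odometer_tracks:
  "tracks (rotated_odometer q \<pi>) (cell_map q \<pi> K) (cell (q * 2 ^ K)) {..<q} {0..<1}"
  unfolding tracks_def
proof (intro ballI)
  fix x :: real assume x: "x \<in> {0..<1}"
  let ?Q = "q * 2 ^ K"
  note r = rot_cell[OF x]
  note k = kakutani_cell(1)[OF r(1)] kakutani_cell(2,3)[where K = K, OF r(1), unfolded r(2)]
  have F: "rotated_odometer q \<pi> x = kakutani (rot q \<pi> x)" unfolding rotated_odometer_def by simp
  show "rotated_odometer q \<pi> x \<in> {0..<1} \<and>
      (cell_map q \<pi> K (cell ?Q x) \<in> {..<q} \<longrightarrow> cell ?Q (rotated_odometer q \<pi> x) \<in> {..<q}) \<and>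
      (cell_map q \<pi> K (cell ?Q x) \<notin> {..<q} \<longrightarrow>
        cell ?Q (rotated_odometer q \<pi> x) = cell_map q \<pi> K (cell ?Q x))"
    unfolding F cell_map_def using k block_flip_less_iff[OF q] by (auto simp: not_less)
qed

end

section \<open>Lebesgue measure of unions of cells\<close>

lemma emeasure_cells:
  assumes Q: "0 < Q" and D: "D \<subseteq> {..<Q}"
  shows "{x \<in> {0..<1}. cell Q x \<in> D} \<in> sets lborel"
    and "emeasure lborel {x \<in> {0..<1}. cell Q x \<in> D} = ennreal (real (card D) / real Q)"
proof -
  have fin: "finite D" using D finite_subset by blast
  have iff: "x \<in> {0..<1} \<and> cell Q x = c \<longleftrightarrow> x \<in> {real c / Q ..< (real c + 1) / Q}" if "c < Q" for x c
  proof -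
    have "real c + 1 \<le> real Q" using that by linarith
    then have 1: "0 \<le> real c / Q" "(real c + 1) / Q \<le> 1" using Q by (simp_all add: field_simps)
    have 2: "real c \<le> Q * x \<longleftrightarrow> real c / Q \<le> x" "Q * x < real c + 1 \<longleftrightarrow> x < (real c + 1) / Q"
      using Q by (simp_all add: field_simps)
    have "x \<in> {0..<1}" if "real c / Q \<le> x" "x < (real c + 1) / Q"
      unfolding atLeastLessThan_iff using that 1 by linarith
    then show ?thesis using cell_eq_iff[OF Q, of x c] 2 by auto
  qed
  have eqc: "{x \<in> {0..<1}. cell Q x = c} = {real c / Q ..< (real c + 1) / Q}" if "c < Q" for c
    unfolding set_eq_iff mem_Collect_eq using iff[OF that] by simp
  have "{x \<in> {0..<1}. cell Q x \<in> D} = (\<Union>c\<in>D. {x \<in> {0..<1}. cell Q x = c})" by auto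
  also have "\<dots> = (\<Union>c\<in>D. {real c / Q ..< (real c + 1) / Q})"
    by (intro SUP_cong refl eqc) (use D in auto)
  finally have eq: "{x \<in> {0..<1}. cell Q x \<in> D} = (\<Union>c\<in>D. {real c / Q ..< (real c + 1) / Q})" .
  show "{x \<in> {0..<1}. cell Q x \<in> D} \<in> sets lborel" unfolding eq using fin by auto
  have disj: "disjoint_family_on (\<lambda>c. {real c / Q ..< (real c + 1) / Q}) D"
    unfolding disjoint_family_on_def
  proof (intro ballI impI)
    fix c d assume cd: "c \<in> D" "d \<in> D" "c \<noteq> d"
    then have "c < Q" "d < Q" using D by auto
    then show "{real c / Q ..< (real c + 1) / Q} \<inter> {real d / Q ..< (real d + 1) / Q} = {}"
      using eqc[of c, symmetric] eqc[of d, symmetric] cd(3) by auto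
  qed
  have "emeasure lborel {x \<in> {0..<1}. cell Q x \<in> D} =
      (\<Sum>c\<in>D. emeasure lborel {real c / Q ..< (real c + 1) / Q})"
    unfolding eq using fin disj by (intro sum_emeasure[symmetric]) auto
  also have "\<dots> = (\<Sum>c\<in>D. ennreal (1 / Q))"
    using Q by (intro sum.cong) (auto simp: field_simps diff_divide_distrib[symmetric])
  also have "\<dots> = ennreal (real (card D) / real Q)"
    by (simp add: ennreal_of_nat_eq_real_of_nat ennreal_mult[symmetric])
  finally show "emeasure lborel {x \<in> {0..<1}. cell Q x \<in> D} = ennreal (real (card D) / real Q)" .
qed

section \<open>Powers of a diagonalizable nonnegative matrix\<close>

lemma mult_mat_entry:
  assumes "A \<in> carrier_mat d d" "B \<in> carrier_mat d d" "i < d" "j < d"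
  shows "(A * B) $$ (i, j) = (\<Sum>k<d. A $$ (i, k) * B $$ (k, j))"
  using assms by (simp add: scalar_prod_def lessThan_atLeast0)

lemma char_poly_diagonal:
  assumes D: "D \<in> carrier_mat d d" "diagonal_mat D"
  shows "char_poly D = (\<Prod>i<d. [:- D $$ (i, i), 1:])"
proof -
  have "upper_triangular D" using D unfolding diagonal_mat_def upper_triangular_def by auto
  then have "char_poly D = (\<Prod>a\<leftarrow>diag_mat D. [:- a, 1:])"
    using char_poly_upper_triangular[OF D(1)] by simp
  also have "\<dots> = (\<Prod>i\<leftarrow>[0..<d]. [:- D $$ (i, i), 1:])"
    unfolding diag_mat_def using D(1) by (simp add: comp_def)
  also have "\<dots> = (\<Prod>i<d. [:- D $$ (i, i), 1:])"
    by (subst prod.distinct_set_conv_list[symmetric]) (simp_all add: lessThan_atLeast0)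
  finally show ?thesis .
qed

text \<open>Used in contrapositive form: a root of order 1 occurs only once on the diagonal.\<close>

lemma order_linear_prod_twice:
  fixes f :: "'b \<Rightarrow> 'a::field"
  assumes "finite S" "i \<in> S" "j \<in> S" "i \<noteq> j" "f i = c" "f j = c"
  shows "order c (\<Prod>i\<in>S. [:- f i, 1:]) \<ge> 2"
proof -
  have "(\<Prod>i\<in>S. [:- f i, 1:]) = [:- c, 1:] * ([:- c, 1:] * (\<Prod>i\<in>S - {i} - {j}. [:- f i, 1:]))"
    using assms by (subst prod.remove[of S i], simp, simp, subst prod.remove[of "S - {i}" j]) auto
  then have "[:- c, 1:] ^ 2 dvd (\<Prod>i\<in>S. [:- f i, 1:])"
    unfolding power2_eq_square mult.assoc[symmetric] by (metis dvd_triv_left)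
  moreover have "(\<Prod>i\<in>S. [:- f i, 1:]) \<noteq> 0" using assms(1) by (simp add: prod_zero_iff)
  ultimately show ?thesis by (rule order_max)
qed

text \<open>If \<open>l > 0\<close> is a left eigenvector of a nonnegative matrix, its eigenvalue is the spectral radius.
  When that eigenvalue is simple, the kernel of \<open>l\<close> is spanned by the other eigenvectors.\<close>

lemma diagonalizable_nonneg_growth:
  fixes A :: "complex mat" and R :: "nat \<Rightarrow> nat \<Rightarrow> real" and l :: "nat \<Rightarrow> real"
    and u :: "nat \<Rightarrow> nat \<Rightarrow> complex"
  assumes A: "A \<in> carrier_mat d d" and d: "2 \<le> d"
    and R: "\<And>a b. a < d \<Longrightarrow> b < d \<Longrightarrow> A $$ (a, b) = of_real (R a b)"
    and R0: "\<And>a b. a < d \<Longrightarrow> b < d \<Longrightarrow> 0 \<le> R a b"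
    and l0: "\<And>a. a < d \<Longrightarrow> 0 < l a"
    and l: "\<And>b. b < d \<Longrightarrow> (\<Sum>a<d. l a * R a b) = \<rho> * l b"
    and \<rho>: "0 < \<rho>"
    and cp: "char_poly A = (\<Prod>\<mu>\<leftarrow>eigs. [:- \<mu>, 1:])"
    and sorted: "sorted_wrt (\<lambda>\<mu> \<nu>. cmod \<mu> \<ge> cmod \<nu>) eigs"
    and lam0: "eigs ! 0 = complex_of_real lam0" "lam0 \<ge> cmod (eigs ! 1)"
    and diag: "diagonalizable A"
    and ord: "order (complex_of_real lam0) (char_poly A) = 1"
    and u0: "(\<Sum>a<d. of_real (l a) * u 0 a) = 0"
    and u: "\<And>k a. a < d \<Longrightarrow> u (Suc k) a = (\<Sum>b<d. A $$ (a, b) * u k b)"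
  shows "lam0 = \<rho>" and "\<exists>C. \<forall>k. \<forall>a<d. cmod (u k a) \<le> C * cmod (eigs ! 1) ^ k"
proof -
  obtain D where D: "diagonal_mat D" "similar_mat A D" using diag unfolding diagonalizable_def by blast
  obtain P P' where "similar_mat_wit A D P P'" using D(2) unfolding similar_mat_def by blast
  note w = similar_mat_witD2[OF A this]
  define dd where "dd i = D $$ (i, i)" for i
  have Dent: "D $$ (i, j) = (if i = j then dd i else 0)" if "i < d" "j < d" for i j
    using D(1) w(5) that unfolding diagonal_mat_def dd_def by auto
  \<comment> \<open>The columns of \<open>P\<close> are right eigenvectors of \<open>A\<close> and
    the rows of \<open>P'\<close> are left eigenvectors; the identities below say this entry by
    entry.\<close>
  have AP: "A * P = P * D"
  proof -
    have "A * P = P * D * P' * P" using w(3) by simp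
    also have "\<dots> = P * D * (P' * P)" using w by (intro assoc_mult_mat) auto
    finally show ?thesis using w by simp
  qed
  have PA: "P' * A = D * P'"
  proof -
    have "P' * A = P' * (P * (D * P'))" using w by (simp add: assoc_mult_mat[of P d d D d P' d])
    also have "\<dots> = P' * P * (D * P')" using w by (intro assoc_mult_mat[symmetric]) auto
    finally show ?thesis using w by simp
  qed
  have eAP: "(\<Sum>b<d. A $$ (a, b) * P $$ (b, i)) = P $$ (a, i) * dd i" if ai: "a < d" "i < d" for a i
  proof -
    have "(\<Sum>b<d. A $$ (a, b) * P $$ (b, i)) = (\<Sum>b<d. P $$ (a, b) * D $$ (b, i))"
      using mult_mat_entry[OF A w(6) ai] mult_mat_entry[OF w(6,5) ai] AP by simp
    also have "\<dots> = (\<Sum>b<d. if b = i then P $$ (a, i) * dd i else 0)"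
      using ai Dent by (intro sum.cong) auto
    finally show ?thesis using ai by simp
  qed
  have ePA: "(\<Sum>a<d. P' $$ (i, a) * A $$ (a, b)) = dd i * P' $$ (i, b)" if ib: "i < d" "b < d" for i b
  proof -
    have "(\<Sum>a<d. P' $$ (i, a) * A $$ (a, b)) = (\<Sum>a<d. D $$ (i, a) * P' $$ (a, b))"
      using mult_mat_entry[OF w(7) A ib] mult_mat_entry[OF w(5,7) ib] PA by simp
    also have "\<dots> = (\<Sum>a<d. if a = i then dd i * P' $$ (i, b) else 0)"
      using ib Dent by (intro sum.cong) auto
    finally show ?thesis using ib by simp
  qed
  have ePP: "(\<Sum>i<d. P $$ (a, i) * P' $$ (i, b)) = (if a = b then 1 else 0)" if "a < d" "b < d" for a b
    using mult_mat_entry[OF w(6,7) that] w(1) that by simp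
  have ePP': "(\<Sum>a<d. P' $$ (i, a) * P $$ (a, j)) = (if i = j then 1 else 0)" if "i < d" "j < d" for i j
    using mult_mat_entry[OF w(7,6) that] w(2) that by simp

  have cpD: "char_poly A = (\<Prod>i<d. [:- dd i, 1:])"
    using char_poly_similar[OF D(2)] char_poly_diagonal[OF w(5) D(1)] unfolding dd_def by simp
  have root1: "poly (char_poly A) z = 0 \<longleftrightarrow> (\<exists>i<d. dd i = z)" for z
    unfolding cpD by (auto simp: poly_prod prod_zero_iff)
  have root2: "poly (char_poly A) z = 0 \<longleftrightarrow> z \<in> set eigs" for z
    unfolding cp by (auto simp: poly_prod_list prod_list_zero_iff)
  have small: "cmod \<mu> \<le> cmod (eigs ! 1)" if \<mu>: "\<mu> \<in> set eigs" "\<mu> \<noteq> of_real lam0" for \<mu>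
  proof -
    obtain j where j: "j < length eigs" "\<mu> = eigs ! j" using \<mu>(1) by (metis in_set_conv_nth)
    \<comment> \<open>Index 0 is excluded because its entry is \<open>lam0\<close>.\<close>
    then have "j = 1 \<or> 1 < j" using \<mu>(2) lam0(1) by (cases j) auto
    then show ?thesis using j sorted_wrt_nth_less[OF sorted, of 1 j] by auto
  qed
  have lam00: "0 \<le> lam0" using lam0(2) norm_ge_zero order_trans by blast
  have le: "cmod (dd i) \<le> lam0" if "i < d" for i
    using small[of "dd i"] root1 root2 lam0(2) lam00 that by (cases "dd i = of_real lam0") (auto intro: order_trans)
  obtain i0 where i0: "i0 < d" "dd i0 = of_real lam0"
    using root1[of "of_real lam0"] ord order_root[of "char_poly A" "of_real lam0"] by auto
  have uniq: "dd i \<noteq> of_real lam0" if "i < d" "i \<noteq> i0" for i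
    using order_linear_prod_twice[of "{..<d}" i i0 dd "of_real lam0"] ord that i0 unfolding cpD by auto

  \<comment> \<open>The pairing of \<open>l\<close> with the \<open>i\<close>-th right eigenvector.
    It can be nonzero only if the eigenvalue is \<open>\<rho>\<close>.\<close>
  define L where "L i = (\<Sum>a<d. of_real (l a) * P $$ (a, i))" for i
  have Leig: "L i * dd i = of_real \<rho> * L i" if i: "i < d" for i
  proof -
    have "L i * dd i = (\<Sum>a<d. of_real (l a) * (\<Sum>b<d. A $$ (a, b) * P $$ (b, i)))"
      unfolding L_def sum_distrib_right using i eAP by (intro sum.cong) (auto simp: mult.assoc)
    also have "\<dots> = (\<Sum>b<d. \<Sum>a<d. of_real (l a) * (A $$ (a, b) * P $$ (b, i)))"
      unfolding sum_distrib_left by (rule sum.swap)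
    also have "\<dots> = (\<Sum>b<d. of_real (\<rho> * l b) * P $$ (b, i))"
    proof (rule sum.cong[OF refl])
      fix b assume "b \<in> {..<d}"
      then have b: "b < d" by simp
      have "(\<Sum>a<d. of_real (l a) * (A $$ (a, b) * P $$ (b, i)))
          = of_real (\<Sum>a<d. l a * R a b) * P $$ (b, i)"
        unfolding of_real_sum sum_distrib_right using b R by (intro sum.cong) auto
      then show "(\<Sum>a<d. of_real (l a) * (A $$ (a, b) * P $$ (b, i))) = of_real (\<rho> * l b) * P $$ (b, i)"
        using l[OF b] by simp
    qed
    also have "\<dots> = of_real \<rho> * L i" unfolding L_def sum_distrib_left by (simp add: mult.assoc)
    finally show ?thesis .
  qed
  have Lu: "(\<Sum>a<d. of_real (l a) * v a) = (\<Sum>i<d. L i * (\<Sum>a<d. P' $$ (i, a) * v a))" for v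
  proof -
    have "(\<Sum>i<d. L i * (\<Sum>a<d. P' $$ (i, a) * v a))
        = (\<Sum>i<d. \<Sum>a<d. \<Sum>b<d. of_real (l b) * P $$ (b, i) * (P' $$ (i, a) * v a))"
      unfolding L_def sum_distrib_right sum_distrib_left by (intro sum.cong refl sum.swap)
    also have "\<dots> = (\<Sum>a<d. \<Sum>i<d. \<Sum>b<d. of_real (l b) * P $$ (b, i) * (P' $$ (i, a) * v a))"
      by (rule sum.swap)
    also have "\<dots> = (\<Sum>a<d. \<Sum>b<d. \<Sum>i<d. of_real (l b) * P $$ (b, i) * (P' $$ (i, a) * v a))"
      by (intro sum.cong refl sum.swap)
    also have "\<dots> = (\<Sum>a<d. \<Sum>b<d. of_real (l b) * v a * (\<Sum>i<d. P $$ (b, i) * P' $$ (i, a)))"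
      unfolding sum_distrib_left by (simp add: algebra_simps)
    also have "\<dots> = (\<Sum>a<d. \<Sum>b<d. if b = a then of_real (l a) * v a else 0)"
      using ePP by (intro sum.cong refl) auto
    also have "\<dots> = (\<Sum>a<d. of_real (l a) * v a)" by simp
    finally show ?thesis by simp
  qed
  \<comment> \<open>The eigenvectors span, so \<open>l\<close> pairs nontrivially with one of them;
    the test vector is the unit vector at 0. Hence \<open>\<rho>\<close> is an eigenvalue.\<close>
  obtain i1 where i1: "i1 < d" "L i1 \<noteq> 0"
  proof -
    have "(\<Sum>a<d. of_real (l a) * (if a = 0 then 1 else 0)) = complex_of_real (l 0)"
      using d by (simp add: if_distrib cong: if_cong)
    then have "(\<Sum>a<d. of_real (l a) * (if a = 0 then 1 else 0)) \<noteq> (0::complex)" using l0[of 0] d by simp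
    then have "\<exists>i<d. L i \<noteq> 0" unfolding Lu using sum.neutral by force
    then show ?thesis using that by blast
  qed
  have "dd i1 = of_real \<rho>" using Leig[OF i1(1)] i1(2) by simp
  then have "\<rho> \<le> lam0" using le[OF i1(1)] \<rho> by simp
  \<comment> \<open>For an eigenvector \<open>w\<close> of \<open>lam0\<close>, the triangle
    inequality gives \<open>lam0 |w| \<le> R |w|\<close> entrywise. Pairing with the positive left
    eigenvector \<open>l\<close> gives \<open>lam0 \<le> \<rho>\<close>.\<close>
  moreover have "lam0 \<le> \<rho>"
  proof -
    let ?w = "\<lambda>a. P $$ (a, i0)"
    have "lam0 * cmod (?w a) \<le> (\<Sum>b<d. R a b * cmod (?w b))" if a: "a < d" for a
    proof -
      have "lam0 * cmod (?w a) = cmod (\<Sum>b<d. A $$ (a, b) * ?w b)"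
        unfolding eAP[OF a i0(1)] i0(2) using lam00 by (simp add: norm_mult)
      also have "\<dots> \<le> (\<Sum>b<d. cmod (A $$ (a, b) * ?w b))" by (rule norm_sum)
      also have "\<dots> = (\<Sum>b<d. R a b * cmod (?w b))"
        using a R R0 by (intro sum.cong) (auto simp: norm_mult)
      finally show ?thesis .
    qed
    then have "(\<Sum>a<d. l a * (lam0 * cmod (?w a))) \<le> (\<Sum>a<d. l a * (\<Sum>b<d. R a b * cmod (?w b)))"
      using l0 by (intro sum_mono mult_left_mono) (auto intro: less_imp_le)
    also have "\<dots> = (\<Sum>b<d. \<Sum>a<d. l a * (R a b * cmod (?w b)))"
      unfolding sum_distrib_left by (rule sum.swap)
    also have "\<dots> = (\<Sum>b<d. (\<Sum>a<d. l a * R a b) * cmod (?w b))"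
      unfolding sum_distrib_right by (simp add: mult.assoc)
    also have "\<dots> = \<rho> * (\<Sum>a<d. l a * cmod (?w a))"
      unfolding sum_distrib_left using l by (intro sum.cong) auto
    finally have "lam0 * (\<Sum>a<d. l a * cmod (?w a)) \<le> \<rho> * (\<Sum>a<d. l a * cmod (?w a))"
      by (simp add: sum_distrib_left mult.left_commute)
    moreover have "0 < (\<Sum>a<d. l a * cmod (?w a))"
    proof -
      have "\<exists>a<d. ?w a \<noteq> 0"
      proof (rule ccontr)
        assume "\<not> (\<exists>a<d. ?w a \<noteq> 0)"
        then have "(\<Sum>a<d. P' $$ (i0, a) * ?w a) = 0" by (intro sum.neutral) auto
        then show False using ePP'[OF i0(1) i0(1)] by simp
      qed
      then obtain a where a: "a < d" "?w a \<noteq> 0" by blast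
      show ?thesis
        by (rule sum_pos2[of _ a]) (use a l0 in \<open>auto intro!: mult_nonneg_nonneg intro: less_imp_le\<close>)
    qed
    ultimately show ?thesis by simp
  qed
  ultimately show eq: "lam0 = \<rho>" by simp

  \<comment> \<open>Coordinates of \<open>u k\<close> in the eigenbasis; each is multiplied by its
    eigenvalue at every step.\<close>
  define y where "y k i = (\<Sum>a<d. P' $$ (i, a) * u k a)" for k i
  have yrec: "y (Suc k) i = dd i * y k i" if i: "i < d" for k i
  proof -
    have "y (Suc k) i = (\<Sum>a<d. \<Sum>b<d. P' $$ (i, a) * (A $$ (a, b) * u k b))"
      unfolding y_def by (simp add: u sum_distrib_left)
    also have "\<dots> = (\<Sum>b<d. \<Sum>a<d. P' $$ (i, a) * (A $$ (a, b) * u k b))" by (rule sum.swap)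
    also have "\<dots> = (\<Sum>b<d. (\<Sum>a<d. P' $$ (i, a) * A $$ (a, b)) * u k b)"
      unfolding sum_distrib_right by (simp add: mult.assoc)
    also have "\<dots> = dd i * y k i"
      unfolding y_def sum_distrib_left using ePA i by (intro sum.cong) (auto simp: mult.assoc)
    finally show ?thesis .
  qed
  have yk: "y k i = dd i ^ k * y 0 i" if "i < d" for k i
    using that by (induction k) (simp_all add: yrec)
  have uk: "u k a = (\<Sum>i<d. P $$ (a, i) * y k i)" if a: "a < d" for k a
  proof -
    have "(\<Sum>i<d. P $$ (a, i) * y k i) = (\<Sum>i<d. \<Sum>b<d. P $$ (a, i) * (P' $$ (i, b) * u k b))"
      unfolding y_def sum_distrib_left by simp
    also have "\<dots> = (\<Sum>b<d. \<Sum>i<d. P $$ (a, i) * (P' $$ (i, b) * u k b))" by (rule sum.swap)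
    also have "\<dots> = (\<Sum>b<d. (\<Sum>i<d. P $$ (a, i) * P' $$ (i, b)) * u k b)"
      unfolding sum_distrib_right by (simp add: mult.assoc)
    also have "\<dots> = (\<Sum>b<d. if b = a then u k a else 0)"
      using ePP[OF a] by (intro sum.cong) auto
    finally show ?thesis using a by simp
  qed
  have L0: "L i = 0" if "i < d" "i \<noteq> i0" for i
    using Leig[OF that(1)] uniq[OF that] eq by auto
  then have "i1 = i0" using i1 by blast
  \<comment> \<open>Since \<open>l\<close> kills every eigenvector except the one at
    \<open>i0\<close>, hypothesis \<open>u0\<close> says precisely that the coordinate at
    \<open>i0\<close> vanishes.\<close>
  have "0 = (\<Sum>i<d. L i * y 0 i)" using u0 Lu[of "u 0"] unfolding y_def by simp
  also have "\<dots> = (\<Sum>i<d. if i = i0 then L i0 * y 0 i0 else 0)"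
    using L0 by (intro sum.cong) auto
  also have "\<dots> = L i0 * y 0 i0" using i0 by simp
  finally have y0: "y 0 i0 = 0" using i1 \<open>i1 = i0\<close> by simp
  have yb: "cmod (y k i) \<le> cmod (y 0 i) * cmod (eigs ! 1) ^ k" if i: "i < d" for k i
  proof (cases "i = i0")
    case True
    then show ?thesis using yk[OF i, of k] y0 by simp
  next
    case False
    then have "cmod (dd i) \<le> cmod (eigs ! 1)" using small uniq[OF i] root1 root2 i by blast
    then have "cmod (dd i) ^ k \<le> cmod (eigs ! 1) ^ k" by (intro power_mono) auto
    then show ?thesis unfolding yk[OF i, of k] norm_mult norm_power
      by (subst mult.commute) (rule mult_left_mono, auto)
  qed
  let ?C = "\<Sum>a<d. \<Sum>i<d. cmod (P $$ (a, i)) * cmod (y 0 i)"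
  have "cmod (u k a) \<le> ?C * cmod (eigs ! 1) ^ k" if a: "a < d" for k a
  proof -
    have "cmod (u k a) \<le> (\<Sum>i<d. cmod (P $$ (a, i) * y k i))"
      unfolding uk[OF a] by (rule norm_sum)
    also have "\<dots> \<le> (\<Sum>i<d. cmod (P $$ (a, i)) * (cmod (y 0 i) * cmod (eigs ! 1) ^ k))"
      unfolding norm_mult using yb by (intro sum_mono mult_left_mono) auto
    also have "\<dots> = (\<Sum>i<d. cmod (P $$ (a, i)) * cmod (y 0 i)) * cmod (eigs ! 1) ^ k"
      by (simp add: sum_distrib_right mult.assoc)
    also have "\<dots> \<le> ?C * cmod (eigs ! 1) ^ k"
      using a by (intro mult_right_mono member_le_sum[of a "{..<d}"]) (auto intro!: sum_nonneg)
    finally show ?thesis .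
  qed
  then show "\<exists>C. \<forall>k. \<forall>a<d. cmod (u k a) \<le> C * cmod (eigs ! 1) ^ k" by blast
qed

section \<open>First returns of a rotated odometer\<close>

context odometer
begin

abbreviation F :: "real \<Rightarrow> real" where "F \<equiv> rotated_odometer q \<pi>"
abbreviation N :: nat where "N \<equiv> level_exp q"
abbreviation L :: "nat \<Rightarrow> real set" where "L \<equiv> level q"
abbreviation R :: "nat \<Rightarrow> real \<Rightarrow> real" where "R k \<equiv> first_return_map F (L k)"
abbreviation cl :: "nat \<Rightarrow> real \<Rightarrow> nat" where "cl k \<equiv> cell (q * 2 ^ (k * N))"
abbreviation A :: "nat set" where "A \<equiv> {..<q * 2 ^ N}"
abbreviation B :: "nat set" where "B \<equiv> {..<q}"

text \<open>What \<open>R k\<close> does to the cells of level \<open>k + 1\<close>, in the sense of \<open>tracks\<close>.\<close>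

definition G :: "nat \<Rightarrow> nat \<Rightarrow> nat" where
  "G k = first_return_map (cell_map q \<pi> (Suc k * N)) A"

text \<open>The height of the tower over \<open>i\<close>. The index is shifted: this is the return
  time t_{k+1,i} of the substitution at level \<open>k + 1\<close>.\<close>

definition T :: "nat \<Rightarrow> nat \<Rightarrow> nat" where
  "T k i = first_return_time (G k) B i"

lemma N_pos: "1 \<le> N"
proof -
  have "\<exists>n\<ge>1. q \<le> 2 ^ n" using q less_exp[of q] by (intro exI[of _ q]) auto
  from LeastI_ex[OF this] show ?thesis unfolding level_exp_def by simp
qed

lemma pow_N: "(2::nat) ^ N = 2 * 2 ^ (N - 1)"
  using N_pos by (cases N) auto

lemma B_subset_A: "B \<subseteq> A"
proof -
  have "q * 1 \<le> q * 2 ^ N" by (intro mult_left_mono) simp_all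
  then show ?thesis by auto
qed

lemma less_A: "i < q \<Longrightarrow> i \<in> A"
  using B_subset_A by (rule subsetD) simp

lemma cell_less_pow: "0 \<le> x \<Longrightarrow> cell (q * 2 ^ K) x < q * 2 ^ M \<longleftrightarrow> x < 2 ^ M / 2 ^ K"
  using q by (simp add: cell_less_iff field_simps)

lemma less_unit: "x < 1 / 2 ^ n \<Longrightarrow> x < (1::real)"
  by (erule less_le_trans) simp

lemma level_eq: "L k = {x \<in> {0..<1}. cl k x \<in> B}"
  using cell_less_pow[of _ "k * N" 0] by (auto simp: level_def intro: less_unit)

lemma level_eq_Suc: "L k = {x \<in> {0..<1}. cl (Suc k) x \<in> A}"
proof -
  have "(2::real) ^ N / 2 ^ (Suc k * N) = 1 / 2 ^ (k * N)" by (simp add: power_add)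
  then show ?thesis using cell_less_pow[of _ "Suc k * N" N] by (auto simp: level_def intro: less_unit)
qed

lemma level_Suc_eq: "L (Suc k) = {x \<in> L k. cl (Suc k) x \<in> B}"
  unfolding level_eq[of "Suc k"] level_eq_Suc[of k] using subsetD[OF B_subset_A] by auto

lemma level_0: "L 0 = {0..<1}"
  by (simp add: level_def)

lemma level_unit: "L k \<subseteq> {0..<1}"
  unfolding level_eq by blast

lemma level_Suc_subset: "L (Suc k) \<subseteq> L k"
  unfolding level_Suc_eq by blast

lemma cl_Suc_div: "x \<in> {0..<1} \<Longrightarrow> cl (Suc k) x div 2 ^ N = cl k x"
  using cell_div[of x "2 ^ N" "q * 2 ^ (k * N)"] by (simp add: power_add ac_simps)

lemma sublevel_iff: "i < q \<Longrightarrow> x \<in> sublevel q k i \<longleftrightarrow> x \<in> {0..<1} \<and> cl k x = i"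
proof -
  assume i: "i < q"
  let ?Q = "real q * 2 ^ (k * N)"
  have Q: "0 < ?Q" using q by simp
  have "real i + 1 \<le> real q * 1" using i by simp
  also have "\<dots> \<le> ?Q" by (intro mult_left_mono) simp_all
  finally have 1: "0 \<le> real i / ?Q" "(real i + 1) / ?Q \<le> 1" using Q by (simp_all add: divide_le_eq)
  have 2: "x \<in> sublevel q k i \<longleftrightarrow> real i \<le> ?Q * x \<and> ?Q * x < real i + 1"
    unfolding sublevel_def using Q by (simp add: divide_le_eq less_divide_eq mult.commute)
  have "x \<in> {0..<1}" if "x \<in> sublevel q k i"
    using that 1 unfolding sublevel_def atLeastLessThan_iff by linarith
  moreover have "cl k x = i \<longleftrightarrow> real i \<le> ?Q * x \<and> ?Q * x < real i + 1" if "x \<in> {0..<1}"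
    using cell_eq_iff[of "q * 2 ^ (k * N)" x i] q that by simp
  ultimately show ?thesis using 2 by blast
qed

lemma sublevel_nonempty: "\<exists>x. x \<in> sublevel q k i"
proof -
  have "0 < real q * 2 ^ (k * N)" using q by simp
  then have "real i / (real q * 2 ^ (k * N)) \<in> sublevel q k i"
    unfolding sublevel_def by (simp add: divide_strict_right_mono)
  then show ?thesis by blast
qed

lemma cells_A_subset: "A \<subseteq> {..<q * 2 ^ (Suc k * N)}"
  using q by (auto simp: power_add intro: less_le_trans)

lemma returns_A: "c \<in> A \<Longrightarrow> returns (cell_map q \<pi> (Suc k * N)) A c"
  by (rule returns_finite[OF _ cell_map_inj cell_map_image cells_A_subset]) simp

lemma G_inj: "inj_on (G k) A" and G_image: "G k ` A \<subseteq> A"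
  unfolding G_def
  using first_return_map_inj[OF _ cell_map_inj cell_map_image cells_A_subset, of k] by simp_all

lemma returns_B: "i \<in> B \<Longrightarrow> returns (G k) B i"
  by (rule returns_finite[OF _ G_inj G_image B_subset_A]) simp

lemma G_funpow_in: "c \<in> A \<Longrightarrow> (G k ^^ n) c \<in> A"
  by (rule funpow_in[OF G_image])

text \<open>Among the cells of level \<open>k + 1\<close>, those in \<open>A\<close> make up
  \<open>L k\<close> and those in \<open>B\<close> make up \<open>L (Suc k)\<close>. So the induced
  map on \<open>L k\<close> is coded exactly until it enters \<open>L (Suc k)\<close>.\<close>

lemma R_tracks: "tracks (R k) (G k) (cl (Suc k)) B (L k)"
  unfolding level_eq_Suc G_def
  by (rule tracks_first_return_map[OF rotated_odometer_tracks B_subset_A returns_A])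

text \<open>The cell permutation is recurrent, and the true orbit follows it until it enters
  \<open>L (Suc k)\<close>, which is contained in \<open>L k\<close>.\<close>

lemma returns_level: "x \<in> L k \<Longrightarrow> returns F (L k) x"
  unfolding level_eq_Suc
  using tracks_return(2)[OF rotated_odometer_tracks _ B_subset_A returns_A] by blast

lemma R_in: "x \<in> L k \<Longrightarrow> (R k ^^ n) x \<in> L k"
  by (rule tracks_funpow_in[OF R_tracks])

lemma R_return:
  assumes "x \<in> L k" "returns (G k) B (cl (Suc k) x)"
  shows "first_return_time (R k) (L (Suc k)) x = T k (cl (Suc k) x)"
    and "returns (R k) (L (Suc k)) x"
  unfolding level_Suc_eq T_def using tracks_return[OF R_tracks assms(1) _ assms(2)] by simp_all

lemma R_return_Suc:
  assumes "x \<in> L (Suc k)"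
  shows "first_return_time (R k) (L (Suc k)) x = T k (cl (Suc k) x)"
  using R_return(1)[of x k] returns_B assms unfolding level_Suc_eq by blast

lemma R_cell:
  assumes "x \<in> L (Suc k)" "j < T k (cl (Suc k) x)"
  shows "cl (Suc k) ((R k ^^ j) x) = (G k ^^ j) (cl (Suc k) x)"
  using assms before_first_return[of _ "G k" B "cl (Suc k) x"] unfolding level_Suc_eq T_def
  by (intro tracks_before[OF R_tracks]) auto

lemma first_return_time_level_0: "x \<in> {0..<1} \<Longrightarrow> first_return_time F (L 0) x = 1"
  using rotated_odometer_tracks[of 0]
  by (intro first_return_time_eqI) (auto simp: level_0 tracks_def)

lemma R_0: "x \<in> {0..<1} \<Longrightarrow> R 0 x = F x"
  unfolding first_return_map_def by (simp add: first_return_time_level_0)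

section \<open>Return times and itineraries in terms of cells\<close>

lemma return_map_funpow: "x \<in> L k \<Longrightarrow> (return_map q \<pi> k ^^ j) x = (R k ^^ j) x"
proof (induction j)
  case (Suc j)
  then have "(R k ^^ j) x \<in> L k" by (intro R_in)
  then show ?case using Suc R_0 level_unit[of k] by (auto simp: return_map_def)
qed simp

lemma return_time_eq:
  assumes i: "i < q"
  shows "return_time q \<pi> (Suc k) i = T k i"
proof -
  have *: "first_return_time (return_map q \<pi> k) (L (Suc k)) x = T k i" if "x \<in> sublevel q (Suc k) i" for x
  proof -
    have x: "x \<in> L (Suc k)" "cl (Suc k) x = i"
      using that i unfolding level_eq sublevel_iff[OF i] by auto
    have "x \<in> L k" using x(1) level_Suc_subset by blast
    then have "first_return_time (return_map q \<pi> k) (L (Suc k)) x = first_return_time (R k) (L (Suc k)) x"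
      unfolding first_return_time_def by (simp add: return_map_funpow)
    then show ?thesis using R_return_Suc[OF x(1)] x(2) by simp
  qed
  show ?thesis unfolding return_time_def
  proof (rule the_equality)
    fix t assume "\<forall>x\<in>sublevel q (Suc k) i. first_return_time (return_map q \<pi> (Suc k - 1)) (L (Suc k)) x = t"
    then show "t = T k i" using sublevel_nonempty[of "Suc k" i] * by auto
  qed (use * in simp)
qed

text \<open>The partition is described by a function \<open>p\<close> of cells of level
  \<open>k + 1\<close>. This serves both alphabets: \<open>p c = c div 2 ^ N\<close> for the
  original letters, and \<open>p = dbl\<close> with \<open>k = 0\<close> for the doubled
  ones.\<close>

lemma itinerary_eq:
  assumes i: "i < q" and p: "\<And>c. c \<in> A \<Longrightarrow> p c < d"
    and P: "\<And>x w. x \<in> L k \<Longrightarrow> w < d \<Longrightarrow> x \<in> P w \<longleftrightarrow> p (cl (Suc k) x) = w"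
  shows "itinerary q \<pi> (Suc k) d P i = map (\<lambda>j. p ((G k ^^ j) i)) [0..<T k i]"
  unfolding itinerary_def return_time_eq[OF i]
proof (rule map_cong[OF refl])
  fix j assume "j \<in> set [0..<T k i]"
  then have j: "j < T k i" by simp
  let ?c = "(G k ^^ j) i"
  let ?S = "(return_map q \<pi> (Suc k - 1) ^^ j) ` sublevel q (Suc k) i"
  have c: "?c \<in> A" using i by (intro G_funpow_in less_A)
  have S: "y \<in> L k \<and> cl (Suc k) y = ?c" if yS: "y \<in> ?S" for y
  proof -
    obtain x where x: "x \<in> sublevel q (Suc k) i" "y = (return_map q \<pi> k ^^ j) x" using yS by auto
    have xL: "x \<in> L (Suc k)" "cl (Suc k) x = i"
      using x i unfolding level_eq sublevel_iff[OF i] by auto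
    have xk: "x \<in> L k" using xL(1) level_Suc_subset by blast
    show ?thesis using R_cell[OF xL(1)] xL(2) j R_in[OF xk] return_map_funpow[OF xk] x(2) by simp
  qed
  obtain y where y: "y \<in> ?S" using sublevel_nonempty[of "Suc k" i] by blast
  show "(THE w. w < d \<and> ?S \<subseteq> P w) = p ?c"
  proof (rule the_equality)
    show "p ?c < d \<and> ?S \<subseteq> P (p ?c)" using p[OF c] P S by auto
    fix w assume "w < d \<and> ?S \<subseteq> P w"
    then show "w = p ?c" using y S[OF y] P[of y w] by auto
  qed
qed

lemma substitution_eq:
  assumes "i < q"
  shows "substitution q \<pi> (Suc k) i = map (\<lambda>j. (G k ^^ j) i div 2 ^ N) [0..<T k i]"
  unfolding substitution_def
proof (rule itinerary_eq[OF assms])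
  fix c assume "c \<in> A"
  then show "c div 2 ^ N < q" by (simp add: div_less_iff_less_mult)
next
  fix x w assume x: "x \<in> L k" and w: "w < q"
  then have "x \<in> {0..<1}" using level_unit by blast
  then show "x \<in> sublevel q (Suc k - 1) w \<longleftrightarrow> cl (Suc k) x div 2 ^ N = w"
    using sublevel_iff[OF w] cl_Suc_div by simp
qed

text \<open>The letter of \<open>\<A>\<close> whose interval contains a given cell of level \<open>1\<close>.\<close>

definition dbl :: "nat \<Rightarrow> nat" where
  "dbl c = (let w = c div 2 ^ N; m = (q - 1) div 2 in
     if even q \<or> w < m \<or> (w = m \<and> 2 * c < q * 2 ^ N) then w else w + 1)"

section \<open>The alphabet with doubled middle symbol\<close>

abbreviation d :: nat where "d \<equiv> alphabet_size q"

lemma dbl_less: "c \<in> A \<Longrightarrow> dbl c < d"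
proof -
  assume "c \<in> A"
  then have "c div 2 ^ N < q" by (simp add: div_less_iff_less_mult)
  then show ?thesis unfolding dbl_def alphabet_size_def Let_def by auto
qed

lemma undouble_dbl: "undouble q (dbl c) = c div 2 ^ N"
  unfolding dbl_def undouble_def Let_def by auto

lemma undouble_less: "a < d \<Longrightarrow> undouble q a < q"
  using q unfolding undouble_def alphabet_size_def by (auto split: if_splits elim!: oddE)

lemma undouble_surj: "i < q \<Longrightarrow> \<exists>a<d. undouble q a = i"
proof (cases "even q \<or> i \<le> (q - 1) div 2")
  case True
  assume "i < q"
  then show ?thesis using True unfolding undouble_def alphabet_size_def by (intro exI[of _ i]) auto
next
  case False
  assume "i < q"
  then show ?thesis using False unfolding undouble_def alphabet_size_def by (intro exI[of _ "i + 1"]) auto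
qed

lemma dbl_surj:
  assumes a: "a < d"
  shows "\<exists>c\<in>A. dbl c = a"
proof (cases "odd q \<and> a = (q - 1) div 2 + 1")
  case True
  define m where "m = (q - 1) div 2"
  have qm: "2 * m + 1 = q" using True unfolding m_def by (auto elim: oddE)
  \<comment> \<open>The cell whose left endpoint is 1/2, a representative of the letter m^-.\<close>
  let ?c = "m * 2 ^ N + 2 ^ (N - 1)"
  have "?c div 2 ^ N = m" using pow_N by simp
  moreover have "2 * ?c = (2 * m + 1) * 2 ^ N" using pow_N by (simp add: algebra_simps)
  then have c2: "2 * ?c = q * 2 ^ N" unfolding qm .
  ultimately have "dbl ?c = a" using True unfolding dbl_def Let_def m_def by simp
  moreover have "?c < 2 * ?c" by simp
  then have "?c < q * 2 ^ N" unfolding c2 .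
  then have "?c \<in> A" by simp
  ultimately show ?thesis by blast
next
  case False
  \<comment> \<open>For every other letter, m^+ included, the leftmost cell of its interval is a
    representative.\<close>
  let ?i = "undouble q a"
  have "?i < q" using undouble_less[OF a] .
  then have "?i * 2 ^ N \<in> A" by simp
  moreover have "dbl (?i * 2 ^ N) = a"
  proof (cases "odd q")
    case True
    let ?m = "(q - 1) div 2"
    have qm: "q = 2 * ?m + 1" using True by (auto elim: oddE)
    have "2 * (?m * 2 ^ N) < q * 2 ^ N" by (subst (2) qm) simp
    then show ?thesis using False True unfolding dbl_def undouble_def Let_def by auto
  next
    case False
    then show ?thesis unfolding dbl_def undouble_def Let_def by auto
  qed
  ultimately show ?thesis by blast
qed

lemma less_half_iff: "x \<in> {0..<1} \<Longrightarrow> x < 1 / 2 \<longleftrightarrow> 2 * cl 1 x < q * 2 ^ N"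
proof -
  assume x: "x \<in> {0..<1}"
  have "2 * cl 1 x < q * 2 ^ N \<longleftrightarrow> cl 1 x < q * 2 ^ (N - 1)" unfolding pow_N by auto
  also have "\<dots> \<longleftrightarrow> x < 2 ^ (N - 1) / 2 ^ N" using cell_less_pow[of x "1 * N" "N - 1"] x by simp
  also have "(2::real) ^ (N - 1) / 2 ^ N = 1 / 2" using N_pos by (cases N) auto
  finally show ?thesis by simp
qed

text \<open>Doubling the middle symbol makes 1/2 a boundary between letters, so the skew function
  depends only on the letter.\<close>

lemma half_dbl_iff: "2 * c < q * 2 ^ N \<longleftrightarrow> 2 * dbl c < d"
proof (cases "even q")
  case True
  then obtain h where h: "q = 2 * h" by (auto elim: evenE)
  have "2 * c < q * 2 ^ N \<longleftrightarrow> c div 2 ^ N < h" unfolding h by (simp add: div_less_iff_less_mult)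
  then show ?thesis using True h unfolding dbl_def alphabet_size_def by simp
next
  case False
  let ?m = "(q - 1) div 2" let ?w = "c div 2 ^ N"
  have qm: "q = 2 * ?m + 1" using False by (auto elim: oddE)
  have d: "d = 2 * ?m + 2" using False qm unfolding alphabet_size_def by simp
  have q2: "q * 2 ^ N = 2 * (?m * 2 ^ N) + 2 ^ N" by (subst qm) (simp add: algebra_simps)
  consider "?w < ?m" | "?w = ?m" | "?w > ?m" by linarith
  then show ?thesis
  proof cases
    case 1
    then have "c < ?m * 2 ^ N" by (simp add: div_less_iff_less_mult)
    then have "2 * c < q * 2 ^ N" unfolding q2 by simp
    then show ?thesis using 1 d unfolding dbl_def Let_def by auto
  next
    case 2
    then show ?thesis using d False unfolding dbl_def Let_def by auto
  next
    case 3
    then have "Suc ?m \<le> ?w" by simp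
    then have "Suc ?m * 2 ^ N \<le> c" by (rule order_trans[OF mult_le_mono1 div_times_less_eq_dividend])
    then have "\<not> 2 * c < q * 2 ^ N" unfolding q2 by simp
    then show ?thesis using 3 d False unfolding dbl_def Let_def by auto
  qed
qed

lemma letter_interval_iff:
  assumes x: "x \<in> {0..<1}" and a: "a < d"
  shows "x \<in> letter_interval q a \<longleftrightarrow> dbl (cl 1 x) = a"
proof -
  have w: "cl 1 x div 2 ^ N = cl 0 x" using cl_Suc_div[OF x, of 0] by simp
  have s: "x \<in> sublevel q 0 (undouble q a) \<longleftrightarrow> cl 0 x = undouble q a"
    using sublevel_iff[OF undouble_less[OF a]] x by simp
  have h: "1 / 2 \<le> x \<longleftrightarrow> \<not> 2 * cl 1 x < q * 2 ^ N" using less_half_iff[OF x] by auto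
  show ?thesis
    unfolding letter_interval_def dbl_def Let_def w using s less_half_iff[OF x] h
    by (auto simp: undouble_def)
qed

text \<open>The word assigned to a letter depends only on its original letter, so the words are
  indexed by \<open>i < q\<close>.\<close>

definition E :: "nat \<Rightarrow> nat list" where
  "E i = map (\<lambda>j. dbl ((G 0 ^^ j) i)) [0..<T 0 i]"

lemma doubled_subst_eq: "a < d \<Longrightarrow> doubled_subst q \<pi> a = E (undouble q a)"
  unfolding doubled_subst_def E_def One_nat_def
  using letter_interval_iff
  by (intro itinerary_eq undouble_less dbl_less) (simp_all add: level_0)

lemma set_E: "i < q \<Longrightarrow> set (E i) \<subseteq> {..<d}"
  unfolding E_def using dbl_less[OF G_funpow_in[OF less_A]] by auto

section \<open>Covering\<close>

text \<open>The floors of the towers over \<open>B\<close> exhaust \<open>A\<close>; equivalently,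
  every cycle of \<open>G k\<close> in \<open>A\<close> meets \<open>B\<close>.\<close>

definition covers :: "nat \<Rightarrow> bool" where
  "covers k \<longleftrightarrow> (\<lambda>(i, j). (G k ^^ j) i) ` tower (G k) B = A"

lemma tower_inj: "inj_on (\<lambda>(i, j). (G k ^^ j) i) (tower (G k) B)"
  by (rule inj_on_tower[OF G_inj G_image B_subset_A])

lemma tower_image: "(\<lambda>(i, j). (G k ^^ j) i) ` tower (G k) B \<subseteq> A"
  unfolding tower_def using G_funpow_in[OF less_A] by auto

lemma card_tower: "card (tower (G k) B) = (\<Sum>i<q. T k i)"
  unfolding tower_def T_def by simp

text \<open>The tower map is injective into \<open>A\<close>, so counting decides. The criterion
  involves only return times, which is how stationarity carries covering from level 0 to all
  levels.\<close>

lemma covers_iff: "covers k \<longleftrightarrow> (\<Sum>i<q. T k i) = q * 2 ^ N"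
proof -
  have 1: "card ((\<lambda>(i, j). (G k ^^ j) i) ` tower (G k) B) = (\<Sum>i<q. T k i)"
    unfolding card_image[OF tower_inj] card_tower ..
  have 2: "card A = q * 2 ^ N" by simp
  show ?thesis
  proof
    assume "covers k"
    then show "(\<Sum>i<q. T k i) = q * 2 ^ N" unfolding covers_def 1[symmetric] by simp
  next
    assume "(\<Sum>i<q. T k i) = q * 2 ^ N"
    then show "covers k" unfolding covers_def
      by (intro card_subset_eq[OF finite_lessThan tower_image]) (simp only: 1 2)
  qed
qed

lemma sum_tower:
  fixes f :: "nat \<Rightarrow> 'b::comm_monoid_add"
  assumes "covers k"
  shows "(\<Sum>i<q. \<Sum>j<T k i. f ((G k ^^ j) i)) = (\<Sum>c\<in>A. f c)"
proof -
  have "(\<Sum>c\<in>A. f c) = (\<Sum>p\<in>tower (G k) B. f ((\<lambda>(i, j). (G k ^^ j) i) p))"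
    using sum.reindex[OF tower_inj, of f k] assms unfolding covers_def by simp
  also have "\<dots> = (\<Sum>i<q. \<Sum>j<T k i. f ((G k ^^ j) i))"
    unfolding tower_def T_def by (subst sum.Sigma) (auto simp: case_prod_unfold)
  finally show ?thesis ..
qed

text \<open>The cells whose orbits avoid the base form an invariant set of positive measure, unless there
  are none.\<close>

lemma ergodic_hits:
  assumes erg: "ergodic Leb F" and c: "c \<in> A"
  shows "\<exists>n. (G 0 ^^ n) c \<in> B"
proof -
  define U where "U = {c \<in> A. \<forall>n. (G 0 ^^ n) c \<notin> B}"
  define X where "X = {x \<in> {0..<1}. cl 1 x \<in> U}"
  have UA: "U \<subseteq> A" unfolding U_def by blast
  have Q: "0 < q * 2 ^ (1 * N)" using q by simp
  have UQ: "U \<subseteq> {..<q * 2 ^ (1 * N)}" using UA by simp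
  have space: "space Leb = {0..<1}" unfolding Leb_def by (simp add: space_restrict_space)
  have setsI: "Y \<in> sets Leb" if "Y \<in> sets lborel" "Y \<subseteq> {0..<1}" for Y
    unfolding Leb_def using that by (subst sets_restrict_space_iff) auto
  have emI: "emeasure Leb Y = emeasure lborel Y" if "Y \<subseteq> {0..<1}" for Y
    unfolding Leb_def using that by (intro emeasure_restrict_space) auto
  have Xs: "X \<subseteq> {0..<1}" unfolding X_def by blast
  have X: "X \<in> sets Leb" unfolding X_def using emeasure_cells(1)[OF Q UQ] by (intro setsI) auto
  have step: "F x \<in> {0..<1}" "G 0 (cl 1 x) \<in> B \<Longrightarrow> cl 1 (F x) \<in> B"
    "G 0 (cl 1 x) \<notin> B \<Longrightarrow> cl 1 (F x) = G 0 (cl 1 x)" "cl 1 x \<in> A" if "x \<in> {0..<1}" for x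
  proof -
    have "x \<in> L 0" using that level_0 by simp
    then have "R 0 x \<in> L 0 \<and> (G 0 (cl (Suc 0) x) \<in> B \<longrightarrow> cl (Suc 0) (R 0 x) \<in> B) \<and>
        (G 0 (cl (Suc 0) x) \<notin> B \<longrightarrow> cl (Suc 0) (R 0 x) = G 0 (cl (Suc 0) x))"
      using R_tracks[of 0] unfolding tracks_def by blast
    then show "F x \<in> {0..<1}" "G 0 (cl 1 x) \<in> B \<Longrightarrow> cl 1 (F x) \<in> B"
      "G 0 (cl 1 x) \<notin> B \<Longrightarrow> cl 1 (F x) = G 0 (cl 1 x)" "cl 1 x \<in> A"
      unfolding R_0[OF that] unfolding level_0 using cell_less[OF Q that] by simp_all
  qed
  \<comment> \<open>The coding is exact at one step both when \<open>x\<close> is in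
    \<open>X\<close> and when \<open>F x\<close> is: an inexact step would put the next cell in
    \<open>B\<close>.\<close>
  have "F x \<in> X \<longleftrightarrow> x \<in> X" if x: "x \<in> {0..<1}" for x
  proof
    assume "x \<in> X"
    then have U: "cl 1 x \<in> U" unfolding X_def by blast
    then have n: "(G 0 ^^ n) (cl 1 x) \<notin> B" for n unfolding U_def by blast
    have e: "cl 1 (F x) = G 0 (cl 1 x)" using n[of 1] step(3)[OF x] by simp
    have "(G 0 ^^ n) (G 0 (cl 1 x)) \<notin> B" for n using n[of "Suc n"] by (simp add: funpow_swap1)
    moreover have "G 0 (cl 1 x) \<in> A" using G_image step(4)[OF x] by blast
    ultimately have "cl 1 (F x) \<in> U" unfolding U_def e by blast
    then show "F x \<in> X" using step(1)[OF x] unfolding X_def by blast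
  next
    assume "F x \<in> X"
    then have U: "cl 1 (F x) \<in> U" unfolding X_def by blast
    then have n: "(G 0 ^^ n) (cl 1 (F x)) \<notin> B" for n unfolding U_def by blast
    have e: "cl 1 (F x) = G 0 (cl 1 x)" using n[of 0] step(2,3)[OF x] by auto
    have n': "(G 0 ^^ Suc n) (cl 1 x) \<notin> B" for n using n[of n] unfolding e by (simp add: funpow_swap1)
    \<comment> \<open>Recurrence exhibits the cell of \<open>x\<close> as one of its own forward
      iterates, all of which avoid \<open>B\<close>.\<close>
    obtain p where p: "p \<ge> 1" "(G 0 ^^ p) (cl 1 x) = cl 1 x"
      using funpow_recurrent[OF _ G_inj G_image step(4)[OF x]] by auto
    then have "cl 1 x \<notin> B" using n'[of "p - 1"] by simp
    then have "(G 0 ^^ n) (cl 1 x) \<notin> B" for n using n' by (cases n) auto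
    then show "x \<in> X" unfolding X_def U_def using x step(4)[OF x] by blast
  qed
  then have "F -` X \<inter> space Leb = X" unfolding space using Xs by blast
  then have "emeasure Leb X = 0 \<or> emeasure Leb (space Leb - X) = 0"
    using erg X unfolding ergodic_def by blast
  \<comment> \<open>The complement contains the cells in \<open>B\<close>, a set of positive
    measure. So \<open>X\<close> is null, and a null union of cells is empty.\<close>
  moreover have "emeasure Leb (space Leb - X) \<noteq> 0"
  proof
    assume "emeasure Leb (space Leb - X) = 0"
    let ?Y = "{x \<in> {0..<1}. cl 1 x \<in> B}"
    have BQ: "B \<subseteq> {..<q * 2 ^ (1 * N)}" using B_subset_A by simp
    have "?Y \<subseteq> space Leb - X" unfolding X_def U_def space
      by (auto intro: exI[of _ 0] dest: spec[of _ 0])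
    then have "emeasure Leb ?Y \<le> emeasure Leb (space Leb - X)"
      using X by (intro emeasure_mono) auto
    then have "emeasure Leb ?Y = 0" using \<open>emeasure Leb (space Leb - X) = 0\<close> by simp
    moreover have "?Y \<subseteq> {0..<1}" by blast
    ultimately have "emeasure lborel ?Y = 0" using emI[of ?Y] by argo
    then show False using emeasure_cells(2)[OF Q BQ] q by simp
  qed
  ultimately have "emeasure lborel X = 0" using emI[OF Xs] by simp
  then have "card U = 0"
    using emeasure_cells(2)[OF Q UQ] q unfolding X_def by (auto simp: divide_le_0_iff)
  then have "U = {}" using UA finite_subset[OF UA] by simp
  then show ?thesis using c unfolding U_def by blast
qed

lemma covers_0:
  assumes erg: "ergodic Leb F"
  shows "covers 0"
proof -
  have "c \<in> (\<lambda>(i, j). (G 0 ^^ j) i) ` tower (G 0) B" if c: "c \<in> A" for c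
  proof -
    obtain n where n: "(G 0 ^^ n) c \<in> B" using ergodic_hits[OF erg c] by blast
    obtain m where m: "m \<ge> 1" "(G 0 ^^ m) c = c"
      using funpow_recurrent[OF _ G_inj G_image c] by auto
    have "(G 0 ^^ (m * n)) c = c" using m(2) by (induction n) (simp_all add: funpow_add)
    moreover have "n \<le> m * n" using m(1) by simp
    \<comment> \<open>The cycle that leads from \<open>c\<close> into \<open>B\<close> is closed, so
      it also leads from \<open>B\<close> back to \<open>c\<close>.\<close>
    ultimately have "c = (G 0 ^^ (m * n - n)) ((G 0 ^^ n) c)" by (simp add: funpow_shift)
    then have ex: "\<exists>p. \<exists>i\<in>B. c = (G 0 ^^ p) i" using n by blast
    define p where "p = (LEAST p. \<exists>i\<in>B. c = (G 0 ^^ p) i)"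
    obtain i where i: "i \<in> B" "c = (G 0 ^^ p) i" using LeastI_ex[OF ex] unfolding p_def by blast
    \<comment> \<open>Otherwise starting from the return point of \<open>i\<close> would reach
      \<open>c\<close> in fewer steps, against the minimality of \<open>p\<close>.\<close>
    have "p < T 0 i"
    proof (rule ccontr)
      assume np: "\<not> p < T 0 i"
      note r = first_return_time[OF returns_B[OF i(1), of 0], folded T_def]
      have "c = (G 0 ^^ (p - T 0 i)) ((G 0 ^^ T 0 i) i)" using i(2) np by (simp add: funpow_shift)
      then have "p \<le> p - T 0 i" unfolding p_def using r(2) by (intro Least_le) blast
      then show False using r(1) np by linarith
    qed
    then have "(i, p) \<in> tower (G 0) B" unfolding tower_def T_def[symmetric] using i(1) by simp
    then show ?thesis using i(2) by force
  qed
  then show ?thesis unfolding covers_def using tower_image by blast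
qed

text \<open>Equal words have equal lengths and equal letters. A letter determines a cell only up to
  \<open>div 2 ^ N\<close>, hence the form of the second claim.\<close>

lemma stationary_T:
  assumes "stationary q \<pi>" "i < q"
  shows "T k i = T 0 i"
    and "j < T 0 i \<Longrightarrow> (G k ^^ j) i div 2 ^ N = (G 0 ^^ j) i div 2 ^ N"
proof -
  have "1 \<le> Suc k" by simp
  with assms have "substitution q \<pi> (Suc k) i = substitution q \<pi> (Suc 0) i"
    unfolding stationary_def One_nat_def by blast
  then have eq: "map (\<lambda>j. (G k ^^ j) i div 2 ^ N) [0..<T k i] = map (\<lambda>j. (G 0 ^^ j) i div 2 ^ N) [0..<T 0 i]"
    unfolding substitution_eq[OF assms(2)] .
  from arg_cong[OF this, of length] show T: "T k i = T 0 i" by simp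
  show "(G k ^^ j) i div 2 ^ N = (G 0 ^^ j) i div 2 ^ N" if "j < T 0 i"
    using arg_cong[OF eq, of "\<lambda>xs. xs ! j"] that T by simp
qed

lemma covers_all:
  assumes "stationary q \<pi>" "ergodic Leb F"
  shows "covers k"
proof -
  have "(\<Sum>i<q. T k i) = (\<Sum>i<q. T 0 i)"
    by (intro sum.cong refl stationary_T(1)[OF assms(1)]) simp
  then show ?thesis using covers_0[OF assms(2)] unfolding covers_iff by argo
qed

definition Tmax :: nat where "Tmax = (\<Sum>i<q. T 0 i)"

text \<open>By covering, \<open>y\<close> lies on some floor \<open>j\<close> above a base cell
  \<open>i\<close>, and climbing the rest of that tower reaches the base. Stationarity makes the
  bound uniform in \<open>k\<close>.\<close>

lemma hits_next_level:
  assumes "stationary q \<pi>" "covers k" and y: "y \<in> L k"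
  shows "returns (R k) (L (Suc k)) y" "first_return_time (R k) (L (Suc k)) y \<le> Tmax"
proof -
  let ?c = "cl (Suc k) y"
  have "?c \<in> A" using y unfolding level_eq_Suc by blast
  then have "?c \<in> (\<lambda>(i, j). (G k ^^ j) i) ` tower (G k) B"
    using assms(2) unfolding covers_def by simp
  then obtain i j where ij: "(i, j) \<in> tower (G k) B" "?c = (G k ^^ j) i"
    by (auto simp: image_iff)
  then have i: "i \<in> B" "j < T k i" unfolding tower_def T_def by auto
  note r = first_return_time[OF returns_B[OF i(1), of k], folded T_def]
  have h: "1 \<le> T k i - j" "(G k ^^ (T k i - j)) ?c \<in> B"
    using i(2) r(2) unfolding ij(2) by (simp_all add: funpow_shift)
  then have ret: "returns (G k) B ?c" unfolding returns_def by blast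
  show "returns (R k) (L (Suc k)) y" by (rule R_return(2)[OF y ret])
  have "first_return_time (R k) (L (Suc k)) y \<le> T k i - j"
    unfolding R_return(1)[OF y ret] T_def using h unfolding T_def by (intro first_return_time_le)
  also have "\<dots> \<le> T k i" by simp
  also have "\<dots> = T 0 i" using i(1) by (intro stationary_T(1)[OF assms(1)]) simp
  also have "\<dots> \<le> Tmax" unfolding Tmax_def using i(1) by (intro member_le_sum) auto
  finally show "first_return_time (R k) (L (Suc k)) y \<le> Tmax" .
qed

section \<open>Sums of the skew function over first returns\<close>

abbreviation W :: "nat \<Rightarrow> real \<Rightarrow> real" where
  "W \<equiv> bsum F (\<lambda>x. real_of_int (skew x))"

definition block_sum :: "nat \<Rightarrow> real \<Rightarrow> real" where
  "block_sum k x = W (first_return_time F (L k) x) x"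

text \<open>The vector M^k v, where v lists the values of the skew function on the letters.\<close>

primrec vec_it :: "nat \<Rightarrow> nat \<Rightarrow> real" where
  "vec_it 0 a = (if 2 * a < d then 1 else - 1)"
| "vec_it (Suc k) a = (\<Sum>b<d. real (count_list (E (undouble q a)) b) * vec_it k b)"

lemma sum_count_list:
  fixes f :: "nat \<Rightarrow> real"
  assumes "set xs \<subseteq> {..<n}"
  shows "(\<Sum>b<n. real (count_list xs b) * f b) = (\<Sum>x\<leftarrow>xs. f x)"
  using assms
proof (induction xs)
  case (Cons x xs)
  have "(\<Sum>b<n. real (count_list (x # xs) b) * f b) =
      (\<Sum>b<n. (if b = x then f x else 0) + real (count_list xs b) * f b)"
    by (intro sum.cong) (auto simp: algebra_simps)
  then show ?case using Cons by (simp add: sum.distrib)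
qed simp

lemma vec_it_Suc:
  assumes "undouble q a = i" "i < q"
  shows "vec_it (Suc k) a = (\<Sum>j<T 0 i. vec_it k (dbl ((G 0 ^^ j) i)))"
proof -
  have "vec_it (Suc k) a = (\<Sum>b\<leftarrow>E i. vec_it k b)"
    using sum_count_list[OF set_E[OF assms(2)]] assms(1) by simp
  also have "\<dots> = (\<Sum>j<T 0 i. vec_it k (dbl ((G 0 ^^ j) i)))"
    unfolding E_def by (simp add: comp_def interv_sum_list_conv_sum_set_nat lessThan_atLeast0)
  finally show ?thesis .
qed

lemma block_sum_Suc:
  assumes x: "x \<in> L (Suc k)"
  shows "block_sum (Suc k) x = (\<Sum>j<T k (cl (Suc k) x). block_sum k ((R k ^^ j) x))"
proof -
  have r: "returns F (L (Suc k)) x" by (rule returns_level[OF x])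
  have "block_sum (Suc k) x = W (visit_time F (L k) (T k (cl (Suc k) x)) x) x"
    unfolding block_sum_def nested_return(2)[OF r level_Suc_subset] R_return_Suc[OF x] ..
  also have "\<dots> = bsum (R k) (block_sum k) (T k (cl (Suc k) x)) x"
    unfolding bsum_visit_time block_sum_def ..
  finally show ?thesis unfolding bsum_def .
qed

lemma block_sum_0: "x \<in> {0..<1} \<Longrightarrow> block_sum 0 x = vec_it 0 (dbl (cl 1 x))"
proof -
  assume x: "x \<in> {0..<1}"
  have "block_sum 0 x = real_of_int (skew x)"
    unfolding block_sum_def first_return_time_level_0[OF x] by (simp add: bsum_def)
  then show ?thesis using less_half_iff[OF x] half_dbl_iff unfolding skew_def by simp
qed

text \<open>A return to \<open>L (Suc k)\<close> is a chain of returns to \<open>L k\<close> that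
  starts in the sublevels spelled out by the substitution. Only the base case distinguishes m^+ from
  m^-; afterwards the two entries of the vector agree, so any \<open>a\<close> with the right
  original letter will do.\<close>

lemma block_sum_eq:
  assumes st: "stationary q \<pi>"
  shows "x \<in> L (Suc k) \<Longrightarrow> undouble q a = cl (Suc k) x \<Longrightarrow> block_sum (Suc k) x = vec_it (Suc k) a"
proof (induction k arbitrary: x a)
  case 0
  let ?i = "cl (Suc 0) x"
  have i: "?i < q" using 0(1) unfolding level_eq by simp
  have x0: "x \<in> L 0" using 0(1) level_Suc_subset by blast
  have "block_sum 0 ((R 0 ^^ j) x) = vec_it 0 (dbl ((G 0 ^^ j) ?i))" if "j < T 0 ?i" for j
    using block_sum_0[of "(R 0 ^^ j) x"] R_in[OF x0] R_cell[OF 0(1) that] unfolding level_0 by simp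
  then show ?case unfolding vec_it_Suc[OF 0(2) i] block_sum_Suc[OF 0(1)] by (intro sum.cong) auto
next
  case (Suc k)
  let ?i = "cl (Suc (Suc k)) x"
  have i: "?i < q" using Suc.prems(1) unfolding level_eq by simp
  have x0: "x \<in> L (Suc k)" using Suc.prems(1) level_Suc_subset by blast
  have "block_sum (Suc k) ((R (Suc k) ^^ j) x) = vec_it (Suc k) (dbl ((G 0 ^^ j) ?i))" if j: "j < T 0 ?i" for j
  proof (rule Suc.IH)
    show y: "(R (Suc k) ^^ j) x \<in> L (Suc k)" by (rule R_in[OF x0])
    have jk: "j < T (Suc k) ?i" using j unfolding stationary_T(1)[OF st i, of "Suc k"] .
    \<comment> \<open>The cell at the coarser level is a quotient of the finer one, and stationarity
      controls exactly this quotient.\<close>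
    have "cl (Suc k) ((R (Suc k) ^^ j) x) = cl (Suc (Suc k)) ((R (Suc k) ^^ j) x) div 2 ^ N"
      using cl_Suc_div[of "(R (Suc k) ^^ j) x" "Suc k"] subsetD[OF level_unit y] by simp
    also have "\<dots> = (G 0 ^^ j) ?i div 2 ^ N"
      unfolding R_cell[OF Suc.prems(1) jk] by (rule stationary_T(2)[OF st i j])
    finally show "undouble q (dbl ((G 0 ^^ j) ?i)) = cl (Suc k) ((R (Suc k) ^^ j) x)"
      unfolding undouble_dbl ..
  qed
  then show ?case
    unfolding vec_it_Suc[OF Suc.prems(2) i] block_sum_Suc[OF Suc.prems(1)] stationary_T(1)[OF st i, of "Suc k"]
    by (intro sum.cong) auto
qed

section \<open>Decomposition of orbit segments\<close>

context
  fixes b :: "nat \<Rightarrow> real"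
  assumes st: "stationary q \<pi>" and cov: "\<And>k. covers k"
    and b: "\<And>k x. x \<in> L k \<Longrightarrow> \<bar>block_sum k x\<bar> \<le> b k"
begin

text \<open>Bound for a segment composed of at most \<open>Tmax\<close> returns to each
  \<open>L j\<close> with \<open>j < k\<close>.\<close>

definition seg :: "nat \<Rightarrow> real" where
  "seg k = real Tmax * (\<Sum>j<k. b j)"

lemma b_nonneg: "0 \<le> b k"
proof -
  have "0 \<in> L k" by (simp add: level_def)
  from b[OF this] show ?thesis by linarith
qed

lemma seg_Suc: "seg (Suc k) = seg k + real Tmax * b k"
  unfolding seg_def by (simp add: algebra_simps)

lemma visits_bound:
  assumes y: "y \<in> L k" and p: "p \<le> Tmax"
  shows "\<bar>W (visit_time F (L k) p y) y\<bar> \<le> real Tmax * b k"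
proof -
  have "W (visit_time F (L k) p y) y = (\<Sum>j<p. block_sum k ((R k ^^ j) y))"
    unfolding bsum_visit_time by (simp add: bsum_def block_sum_def)
  also have "\<bar>\<dots>\<bar> \<le> (\<Sum>j<p. \<bar>block_sum k ((R k ^^ j) y)\<bar>)" by (rule sum_abs)
  also have "\<dots> \<le> (\<Sum>j<p. b k)" using b R_in[OF y] by (intro sum_mono) auto
  also have "\<dots> \<le> real Tmax * b k" using p b_nonneg by (simp add: mult_right_mono)
  finally show ?thesis .
qed

text \<open>Within \<open>Tmax\<close> returns to \<open>L k\<close> the orbit enters
  \<open>L (Suc k)\<close>; with more returns this visit would fall strictly inside the
  segment.\<close>

lemma before_next_level:
  assumes y: "y \<in> L k"
    and no: "\<And>t. 1 \<le> t \<Longrightarrow> t < visit_time F (L k) p y \<Longrightarrow> (F ^^ t) y \<notin> L (Suc k)"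
  shows "p \<le> Tmax"
proof (rule ccontr)
  assume "\<not> p \<le> Tmax"
  let ?r = "first_return_time (R k) (L (Suc k)) y"
  note h = hits_next_level[OF st cov y]
  note r = first_return_time[OF h(1)]
  have rp: "?r < p" using h(2) \<open>\<not> p \<le> Tmax\<close> by linarith
  have ret: "returns F (L k) ((R k ^^ j) y)" for j by (rule returns_level[OF R_in[OF y]])
  have "0 < visit_time F (L k) ?r y"
    using visit_time_less[of 0 ?r F "L k" y] r(1) ret[of 0] by simp
  moreover have "visit_time F (L k) ?r y < visit_time F (L k) p y" by (rule visit_time_less[OF rp ret])
  moreover have "(F ^^ visit_time F (L k) ?r y) y \<in> L (Suc k)"
    using r(2) unfolding funpow_first_return_map .
  ultimately show False using no by auto
qed

text \<open>The segment up to the first entrance into \<open>L (Suc k)\<close> is cut at the first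
  entrance into \<open>L k\<close>; what remains consists of at most \<open>Tmax\<close> returns to
  \<open>L k\<close>.\<close>

lemma first_segment:
  "x \<in> {0..<1} \<Longrightarrow> (F ^^ u) x \<in> L k \<Longrightarrow> (\<And>t. t < u \<Longrightarrow> (F ^^ t) x \<notin> L k) \<Longrightarrow> \<bar>W u x\<bar> \<le> seg k"
proof (induction k arbitrary: u)
  case 0
  have "u = 0" using 0(3)[of 0] 0(1) unfolding level_0 by auto
  then show ?case by (simp add: seg_def)
next
  case (Suc k)
  define u0 where "u0 = (LEAST t. (F ^^ t) x \<in> L k)"
  let ?y = "(F ^^ u0) x"
  have uk: "(F ^^ u) x \<in> L k" using Suc.prems(2) level_Suc_subset by blast
  then have y: "?y \<in> L k" and u0: "u0 \<le> u" and before: "\<And>t. t < u0 \<Longrightarrow> (F ^^ t) x \<notin> L k"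
    unfolding u0_def by (auto intro: LeastI Least_le dest: not_less_Least)
  have 1: "\<bar>W u0 x\<bar> \<le> seg k" by (rule Suc.IH[OF Suc.prems(1) y before])
  have 2: "\<exists>p. u - u0 = visit_time F (L k) p ?y"
  proof (cases "u = u0")
    case True
    then show ?thesis by (intro exI[of _ 0]) simp
  next
    case False
    then have "1 \<le> u - u0" using u0 by simp
    moreover have "(F ^^ (u - u0)) ?y \<in> L k" using uk u0 by (simp add: funpow_shift)
    ultimately show ?thesis using visit_time_surj[of "u - u0" F ?y "L k"] by blast
  qed
  then obtain p where p: "u - u0 = visit_time F (L k) p ?y" by blast
  have "p \<le> Tmax"
  proof (rule before_next_level[OF y])
    fix t assume "1 \<le> t" "t < visit_time F (L k) p ?y"
    then show "(F ^^ t) ?y \<notin> L (Suc k)" unfolding p[symmetric] funpow_shift by (intro Suc.prems(3)) simp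
  qed
  then have "\<bar>W (u - u0) ?y\<bar> \<le> real Tmax * b k" unfolding p by (rule visits_bound[OF y])
  moreover have "W u x = W u0 x + W (u - u0) ?y"
    using bsum_add[of F "\<lambda>x. real_of_int (skew x)" u0 "u - u0" x] u0 by simp
  ultimately show ?case using 1 unfolding seg_Suc by linarith
qed

text \<open>Cut at the last visit to \<open>L k\<close>. The start is only required to be in
  \<open>L k\<close>, not in \<open>L (Suc k)\<close>, because \<open>segment_bound\<close> applies
  the step at the deepest level visited.\<close>

lemma last_segment_step:
  assumes IH: "\<And>z n. z \<in> L k \<Longrightarrow> (\<And>t. 1 \<le> t \<Longrightarrow> t \<le> n \<Longrightarrow> (F ^^ t) z \<notin> L k) \<Longrightarrow> \<bar>W n z\<bar> \<le> seg k"
    and y: "y \<in> L k" and no: "\<And>t. 1 \<le> t \<Longrightarrow> t \<le> n \<Longrightarrow> (F ^^ t) y \<notin> L (Suc k)"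
  shows "\<bar>W n y\<bar> \<le> seg (Suc k)"
proof -
  let ?V = "{t. t \<le> n \<and> (F ^^ t) y \<in> L k}"
  define t0 where "t0 = Max ?V"
  have V: "finite ?V" "?V \<noteq> {}" using y by auto
  have mx: "t \<le> t0" if "t \<in> ?V" for t unfolding t0_def using V(1) that by (rule Max_ge)
  have "t0 \<in> ?V" unfolding t0_def using V by (rule Max_in)
  then have t0: "t0 \<le> n" "(F ^^ t0) y \<in> L k" by blast+
  let ?z = "(F ^^ t0) y"
  have 1: "\<bar>W (n - t0) ?z\<bar> \<le> seg k"
  proof (rule IH[OF t0(2)])
    fix t assume t: "1 \<le> t" "t \<le> n - t0"
    have "t0 + t \<le> n" using t(2) t0(1) by linarith
    moreover have "\<not> t0 + t \<le> t0" using t(1) by linarith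
    ultimately show "(F ^^ t) ?z \<notin> L k" using mx[of "t0 + t"] unfolding funpow_shift by blast
  qed
  have "\<exists>p. t0 = visit_time F (L k) p y"
  proof (cases "t0 = 0")
    case True
    then show ?thesis by (intro exI[of _ 0]) simp
  next
    case False
    then show ?thesis using visit_time_surj[of t0 F y "L k"] t0 by auto
  qed
  then obtain p where p: "t0 = visit_time F (L k) p y" by blast
  have "p \<le> Tmax"
    by (rule before_next_level[OF y]) (use no t0(1) p in auto)
  then have "\<bar>W t0 y\<bar> \<le> real Tmax * b k" unfolding p by (rule visits_bound[OF y])
  moreover have "W n y = W t0 y + W (n - t0) ?z"
    using bsum_add[of F "\<lambda>x. real_of_int (skew x)" t0 "n - t0" y] t0(1) by simp
  ultimately show ?thesis using 1 unfolding seg_Suc by linarith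
qed

lemma last_segment:
  "z \<in> L k \<Longrightarrow> (\<And>t. 1 \<le> t \<Longrightarrow> t \<le> n \<Longrightarrow> (F ^^ t) z \<notin> L k) \<Longrightarrow> \<bar>W n z\<bar> \<le> seg k"
proof (induction k arbitrary: z n)
  case 0
  have "(F ^^ 1) z \<in> L 0"
    using tracks_funpow_in[OF rotated_odometer_tracks, of z 1] 0(1) unfolding level_0 .
  then have "n = 0" using 0(2)[of 1] by (cases n) auto
  then show ?case by (simp add: seg_def)
next
  case (Suc k)
  have z: "z \<in> L k" using Suc.prems(1) level_Suc_subset by blast
  show ?case
  proof (rule last_segment_step[OF _ z Suc.prems(2)])
    fix z n assume "z \<in> L k" "\<And>t. 1 \<le> t \<Longrightarrow> t \<le> n \<Longrightarrow> (F ^^ t) z \<notin> L k"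
    then show "\<bar>W n z\<bar> \<le> seg k" by (rule Suc.IH)
  qed
qed

text \<open>Cut at the first entrance into the deepest level visited: \<open>first_segment\<close>
  treats the descent to it and \<open>last_segment_step\<close> the rest, whence the factor
  2.\<close>

lemma segment_bound:
  "x \<in> {0..<1} \<Longrightarrow> (\<And>t. t \<le> n \<Longrightarrow> (F ^^ t) x \<notin> L k) \<Longrightarrow> \<bar>W n x\<bar> \<le> 2 * seg k"
proof (induction k)
  case 0
  then show ?case using 0(2)[of 0] unfolding level_0 by auto
next
  case (Suc k)
  have mono: "seg k \<le> seg (Suc k)" unfolding seg_Suc using b_nonneg by simp
  show ?case
  proof (cases "\<exists>t\<le>n. (F ^^ t) x \<in> L k")
    case False
    then have "\<bar>W n x\<bar> \<le> 2 * seg k" using Suc.IH Suc.prems(1) by blast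
    then show ?thesis using mono by linarith
  next
    case True
    then obtain t where t: "t \<le> n" "(F ^^ t) x \<in> L k" by blast
    define u where "u = (LEAST t. (F ^^ t) x \<in> L k)"
    have u: "(F ^^ u) x \<in> L k" "u \<le> t" "\<And>t. t < u \<Longrightarrow> (F ^^ t) x \<notin> L k"
      using t(2) unfolding u_def by (auto intro: LeastI Least_le dest: not_less_Least)
    have 1: "\<bar>W u x\<bar> \<le> seg k" by (rule first_segment[OF Suc.prems(1) u(1,3)])
    have 2: "\<bar>W (n - u) ((F ^^ u) x)\<bar> \<le> seg (Suc k)"
    proof (rule last_segment_step[OF last_segment u(1)])
      fix s assume "1 \<le> s" "s \<le> n - u"
      then show "(F ^^ s) ((F ^^ u) x) \<notin> L (Suc k)"
        unfolding funpow_shift using u(2) t(1) by (intro Suc.prems(2)) linarith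
    qed
    have "W n x = W u x + W (n - u) ((F ^^ u) x)"
      using bsum_add[of F "\<lambda>x. real_of_int (skew x)" u "n - u" x] u(2) t(1) by simp
    then show ?thesis using 1 2 mono by linarith
  qed
qed

end

section \<open>Almost every orbit visits deep levels late\<close>

text \<open>If the true orbit enters \<open>L k\<close> by time \<open>n\<close>, so does the orbit
  of its cell under the permutation. For each time, injectivity leaves at most \<open>q\<close> such
  cells. As a union of cells, \<open>V\<close> is measurable.\<close>

lemma late_visits_measure:
  "\<exists>V\<in>sets lborel. emeasure lborel V \<le> ennreal ((real n + 1) * (1 / 2 ^ N) ^ k) \<and>
     (\<forall>x\<in>{0..<1}. \<forall>t\<le>n. (F ^^ t) x \<in> L k \<longrightarrow> x \<in> V)"
proof -
  let ?Q = "q * 2 ^ (k * N)" let ?g = "cell_map q \<pi> (k * N)"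
  define D where "D t = {c. c < ?Q \<and> (?g ^^ t) c < q}" for t
  define V where "V = {x \<in> {0..<1}. cl k x \<in> (\<Union>t\<le>n. D t)}"
  have Q: "0 < ?Q" using q by simp
  have D: "(\<Union>t\<le>n. D t) \<subseteq> {..<?Q}" unfolding D_def by auto
  have "card (D t) \<le> q" for t
  proof -
    have "inj_on (?g ^^ t) (D t)"
    proof (rule inj_onI)
      fix x y assume "x \<in> D t" "y \<in> D t" "(?g ^^ t) x = (?g ^^ t) y"
      then show "x = y"
        using funpow_cancel[OF cell_map_inj cell_map_image, of x "k * N" y t] unfolding D_def by simp
    qed
    moreover have "(?g ^^ t) ` D t \<subseteq> {..<q}" unfolding D_def by auto
    ultimately have "card (D t) \<le> card {..<q}" by (rule card_inj_on_le) simp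
    then show ?thesis by simp
  qed
  then have "(\<Sum>t\<le>n. card (D t)) \<le> (\<Sum>t\<le>n. q)" by (intro sum_mono)
  moreover have "card (\<Union>t\<le>n. D t) \<le> (\<Sum>t\<le>n. card (D t))" by (rule card_UN_le) simp
  ultimately have "card (\<Union>t\<le>n. D t) \<le> (n + 1) * q" by simp
  then have "real (card (\<Union>t\<le>n. D t)) \<le> real ((n + 1) * q)" by (simp only: of_nat_le_iff)
  then have "real (card (\<Union>t\<le>n. D t)) / real ?Q \<le> real ((n + 1) * q) / real ?Q"
    by (intro divide_right_mono) simp_all
  also have "\<dots> = (real n + 1) / 2 ^ (k * N)" using q by (simp add: field_simps)
  also have "\<dots> = (real n + 1) * (1 / 2 ^ N) ^ k" by (simp add: power_one_over power_mult mult.commute[of k])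
  finally have "emeasure lborel V \<le> ennreal ((real n + 1) * (1 / 2 ^ N) ^ k)"
    unfolding V_def emeasure_cells(2)[OF Q D] by (rule ennreal_leI)
  moreover have "V \<in> sets lborel" unfolding V_def by (rule emeasure_cells(1)[OF Q D])
  moreover have "x \<in> V" if x: "x \<in> {0..<1}" and t: "t \<le> n" "(F ^^ t) x \<in> L k" for x t
  proof (rule ccontr)
    assume "x \<notin> V"
    then have no: "(?g ^^ s) (cl k x) \<notin> B" if "s \<le> n" for s
      using that x cell_less[OF Q x] unfolding V_def D_def by auto
    have "cl k ((F ^^ t) x) = (?g ^^ t) (cl k x)"
      by (rule tracks_before[OF rotated_odometer_tracks x]) (use no t(1) in auto)
    then show False using no[OF t(1)] t(2) unfolding level_eq by simp
  qed
  ultimately show ?thesis by blast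
qed

text \<open>Borel-Cantelli with the geometric bound \<open>2 * (r / 2 ^ N) ^ k\<close>; the 2
  absorbs the extra 1 in \<open>n k + 1\<close>, since \<open>1 \<le> r ^ k\<close>.\<close>

lemma AE_late_visits:
  assumes r: "1 < r" "r < 2 ^ N"
  shows "AE x in lborel. x \<in> {0..<1} \<longrightarrow>
    (\<forall>\<^sub>F k in sequentially. \<forall>t. real t \<le> r ^ k \<longrightarrow> (F ^^ t) x \<notin> L k)"
proof -
  define n where "n k = nat \<lfloor>r ^ k\<rfloor>" for k
  define V where "V k = (SOME V. V \<in> sets lborel \<and>
     emeasure lborel V \<le> ennreal ((real (n k) + 1) * (1 / 2 ^ N) ^ k) \<and>
     (\<forall>x\<in>{0..<1}. \<forall>t\<le>n k. (F ^^ t) x \<in> L k \<longrightarrow> x \<in> V))" for k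
  have V: "V k \<in> sets lborel"
    "emeasure lborel (V k) \<le> ennreal ((real (n k) + 1) * (1 / 2 ^ N) ^ k)"
    "\<And>x t. x \<in> {0..<1} \<Longrightarrow> t \<le> n k \<Longrightarrow> (F ^^ t) x \<in> L k \<Longrightarrow> x \<in> V k" for k
    using someI_ex[OF late_visits_measure[of "n k" k, unfolded Bex_def]] unfolding V_def[symmetric] by blast+
  have r1: "1 \<le> r ^ k" for k using r(1) by (intro one_le_power) simp
  have nk: "real t \<le> r ^ k \<longleftrightarrow> t \<le> n k" for t k
    unfolding n_def using r1[of k] by (simp add: le_nat_floor le_nat_iff le_floor_iff)
  have bound: "(real (n k) + 1) * (1 / 2 ^ N) ^ k \<le> 2 * (r / 2 ^ N) ^ k" for k
  proof -
    have "real (n k) \<le> r ^ k" using nk by blast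
    then have "(real (n k) + 1) * (1 / 2 ^ N) ^ k \<le> (2 * r ^ k) * (1 / 2 ^ N) ^ k"
      using r1[of k] by (intro mult_right_mono) auto
    then show ?thesis by (simp add: power_divide)
  qed
  have m: "emeasure lborel (V k) \<le> ennreal (2 * (r / 2 ^ N) ^ k)" for k
    using V(2)[of k] ennreal_leI[OF bound[of k]] by (rule order_trans)
  have fin: "emeasure lborel (V k) < \<infinity>" for k
    using m[of k] by (rule le_less_trans) simp
  have "summable (\<lambda>k. measure lborel (V k))"
  proof (rule summable_comparison_test)
    have "measure lborel (V k) \<le> 2 * (r / 2 ^ N) ^ k" for k
      unfolding measure_def using m[of k] r by (intro enn2real_leI) auto
    then show "\<exists>K. \<forall>k\<ge>K. norm (measure lborel (V k)) \<le> 2 * (r / 2 ^ N) ^ k" by auto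
    show "summable (\<lambda>k. 2 * (r / 2 ^ N) ^ k)"
      using r by (intro summable_mult summable_geometric) simp
  qed
  then have "AE x in lborel. \<forall>\<^sub>F k in sequentially. x \<in> space lborel - V k"
    by (intro borel_cantelli_AE1 V(1) fin)
  then show ?thesis
  proof eventually_elim
    case (elim x)
    show ?case
    proof
      assume x: "x \<in> {0..<1}"
      from elim show "\<forall>\<^sub>F k in sequentially. \<forall>t. real t \<le> r ^ k \<longrightarrow> (F ^^ t) x \<notin> L k"
        by eventually_elim (use V(3)[OF x] nk in blast)
    qed
  qed
qed

section \<open>The letter frequencies\<close>

text \<open>The length of the interval of the letter, multiplied by
  \<open>q * 2 ^ N\<close>.\<close>

definition letter_weight :: "nat \<Rightarrow> real" where
  "letter_weight a = real (card {c \<in> A. dbl c = a})"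

lemma letter_weight_pos: "a < d \<Longrightarrow> 0 < letter_weight a"
  using dbl_surj[of a] unfolding letter_weight_def by (auto simp: card_gt_0_iff)

lemma sum_letter_weight: "(\<Sum>a<d. letter_weight a * f a) = (\<Sum>c\<in>A. f (dbl c))"
proof -
  have "(\<Sum>c\<in>A. f (dbl c)) = (\<Sum>a<d. \<Sum>c\<in>{c \<in> A. dbl c = a}. f (dbl c))"
    using dbl_less by (intro sum.group[symmetric]) auto
  also have "\<dots> = (\<Sum>a<d. letter_weight a * f a)"
    unfolding letter_weight_def by (intro sum.cong) auto
  finally show ?thesis ..
qed

text \<open>Summed over the cells of \<open>A\<close>, each word \<open>E i\<close> is counted
  \<open>2 ^ N\<close> times. The towers exhaust \<open>A\<close> without overlap, so the words
  together contain each letter as often as there are cells carrying it.\<close>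

lemma letter_weight_eigen:
  assumes "covers 0"
  shows "(\<Sum>a<d. letter_weight a * real (count_list (E (undouble q a)) b)) = 2 ^ N * letter_weight b"
proof -
  have cnt: "real (count_list (E i) b) = (\<Sum>j<T 0 i. if dbl ((G 0 ^^ j) i) = b then 1 else 0)" for i
  proof -
    have "real (count_list (map f xs) b) = (\<Sum>x\<leftarrow>xs. if f x = b then 1 else 0)" for f and xs :: "nat list"
      by (induction xs) auto
    then show ?thesis
      unfolding E_def by (simp add: interv_sum_list_conv_sum_set_nat lessThan_atLeast0)
  qed
  have "(\<Sum>a<d. letter_weight a * real (count_list (E (undouble q a)) b))
      = (\<Sum>c\<in>A. real (count_list (E (c div 2 ^ N)) b))"
    unfolding sum_letter_weight undouble_dbl ..
  also have "\<dots> = (\<Sum>i<q. \<Sum>c\<in>{i * 2 ^ N..<i * 2 ^ N + 2 ^ N}. real (count_list (E (c div 2 ^ N)) b))"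
    by (rule sum.nat_group[symmetric])
  also have "\<dots> = (\<Sum>i<q. 2 ^ N * real (count_list (E i) b))"
  proof (rule sum.cong[OF refl])
    fix i :: nat
    have "c div 2 ^ N = i" if "c \<in> {i * 2 ^ N..<i * 2 ^ N + 2 ^ N}" for c
      using that by (intro div_nat_eqI) (auto simp: mult.commute)
    then have "(\<Sum>c\<in>{i * 2 ^ N..<i * 2 ^ N + 2 ^ N}. real (count_list (E (c div 2 ^ N)) b))
        = (\<Sum>c\<in>{i * 2 ^ N..<i * 2 ^ N + 2 ^ N}. real (count_list (E i) b))"
      by (intro sum.cong) auto
    then show "(\<Sum>c\<in>{i * 2 ^ N..<i * 2 ^ N + 2 ^ N}. real (count_list (E (c div 2 ^ N)) b))
        = 2 ^ N * real (count_list (E i) b)" by simp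
  qed
  also have "\<dots> = 2 ^ N * (\<Sum>i<q. \<Sum>j<T 0 i. if dbl ((G 0 ^^ j) i) = b then 1 else 0)"
    unfolding sum_distrib_left cnt ..
  also have "\<dots> = 2 ^ N * (\<Sum>c\<in>A. if dbl c = b then 1 else 0)"
    unfolding sum_tower[OF assms, of "\<lambda>c. if dbl c = b then 1 else 0"] ..
  also have "(\<Sum>c\<in>A. if dbl c = b then 1 else 0) = letter_weight b"
    unfolding letter_weight_def by (subst sum.inter_filter[symmetric]) simp_all
  finally show ?thesis .
qed

text \<open>The mean of the skew function is zero: half of the cells lie to the left of 1/2.\<close>

lemma letter_weight_skew: "(\<Sum>a<d. letter_weight a * vec_it 0 a) = 0"
proof -
  let ?H = "q * 2 ^ (N - 1)"
  have H: "q * 2 ^ N = 2 * ?H" using pow_N by simp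
  have "(\<Sum>a<d. letter_weight a * vec_it 0 a) = (\<Sum>c\<in>A. if 2 * c < q * 2 ^ N then 1 else - 1)"
    unfolding sum_letter_weight half_dbl_iff by simp
  also have "\<dots> = (\<Sum>c<2 * ?H. if c < ?H then 1 else - 1)" unfolding H by simp
  also have "\<dots> = (\<Sum>c\<in>{0..<?H}. if c < ?H then 1 else - 1) + (\<Sum>c\<in>{?H..<2 * ?H}. if c < ?H then 1 else - 1)"
    unfolding lessThan_atLeast0 by (rule sum.atLeastLessThan_concat[symmetric]) simp_all
  also have "\<dots> = 0" by simp
  finally show ?thesis .
qed

lemma extension_funpow:
  "(extension q \<pi> ^^ n) (x, k) = ((F ^^ n) x, k + bsum F skew n x)"
  by (induction n) (simp_all add: extension_def bsum_Suc)

end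

section \<open>The diffusion coefficient\<close>

text \<open>Apply the bound at the least \<open>k\<close> with \<open>n \<le> r ^ k\<close>. It
  exceeds \<open>ln n / ln r\<close> by at most 1, which costs a constant factor that vanishes after
  division by \<open>ln n\<close>.\<close>

lemma limsup_elog_le:
  fixes w :: "nat \<Rightarrow> real"
  assumes \<beta>: "1 < \<beta>" and r: "1 < r"
    and w: "\<forall>\<^sub>F k in sequentially. \<forall>n. real n \<le> r ^ k \<longrightarrow> \<bar>w n\<bar> \<le> C * \<beta> ^ k"
  shows "limsup (\<lambda>n. elog \<bar>w n\<bar> / ereal (ln (real n))) \<le> ereal (ln \<beta> / ln r)"
proof -
  \<comment> \<open>Ensures a positive constant, so that its logarithm can be split off.\<close>
  define K where "K = max C 1"
  have lr: "0 < ln r" and lb: "0 < ln \<beta>" using r \<beta> by simp_all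
  define k where "k n = nat \<lceil>ln (real n) / ln r\<rceil>" for n
  have "filterlim (\<lambda>n. ln (real n) / ln r) at_top sequentially"
    using lr by real_asymp
  then have "filterlim k at_top sequentially"
    unfolding filterlim_at_top
  proof (intro allI)
    fix Z assume "\<forall>Z. \<forall>\<^sub>F n in sequentially. Z \<le> ln (real n) / ln r"
    then have "\<forall>\<^sub>F n in sequentially. real Z \<le> ln (real n) / ln r" ..
    then show "\<forall>\<^sub>F n in sequentially. Z \<le> k n"
      by eventually_elim (unfold k_def, linarith)
  qed
  from eventually_compose_filterlim[OF w this]
  have ev: "\<forall>\<^sub>F n in sequentially. \<forall>m. real m \<le> r ^ k n \<longrightarrow> \<bar>w m\<bar> \<le> C * \<beta> ^ k n" .
  have "\<forall>\<^sub>F n in sequentially. elog \<bar>w n\<bar> / ereal (ln (real n))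
      \<le> ereal ((ln K + ln \<beta>) / ln (real n) + ln \<beta> / ln r)"
    using ev eventually_ge_at_top[of 2]
  proof eventually_elim
    case (elim n)
    have ln: "0 < ln (real n)" using elim(2) by simp
    have kn: "ln (real n) / ln r \<le> real (k n)" "real (k n) \<le> ln (real n) / ln r + 1"
      unfolding k_def using ln lr by (auto simp: of_nat_nat less_imp_le real_nat_ceiling_ge)
    have "ln (real n) \<le> real (k n) * ln r" using kn(1) lr by (simp add: divide_le_eq)
    also have "\<dots> = ln (r ^ k n)" using r by (simp add: ln_realpow)
    finally have "real n \<le> r ^ k n" using elim(2) r by simp
    then have "\<bar>w n\<bar> \<le> C * \<beta> ^ k n" using elim(1) by blast
    also have "\<dots> \<le> K * \<beta> ^ k n" unfolding K_def using \<beta> by (intro mult_right_mono) auto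
    finally have wK: "\<bar>w n\<bar> \<le> K * \<beta> ^ k n" .
    show ?case
    proof (cases "w n = 0")
      \<comment> \<open>Here the quotient is minus infinity, because \<open>ln n\<close> is positive
        for \<open>n \<ge> 2\<close>.\<close>
      case True
      then show ?thesis using ln by (simp add: elog_def)
    next
      case False
      have "ln \<bar>w n\<bar> \<le> ln (K * \<beta> ^ k n)" using wK False by (intro ln_mono) auto
      also have "\<dots> = ln K + real (k n) * ln \<beta>"
        unfolding K_def using \<beta> by (simp add: ln_mult ln_realpow)
      also have "\<dots> \<le> ln K + (ln (real n) / ln r + 1) * ln \<beta>"
        using kn(2) lb by (simp add: mult_right_mono)
      finally have "ln \<bar>w n\<bar> / ln (real n) \<le> (ln K + (ln (real n) / ln r + 1) * ln \<beta>) / ln (real n)"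
        using ln by (intro divide_right_mono) auto
      also have "\<dots> = (ln K + ln \<beta>) / ln (real n) + ln \<beta> / ln r" using ln lr by (simp add: field_simps)
      finally show ?thesis using False ln by (simp add: elog_def)
    qed
  qed
  then have "limsup (\<lambda>n. elog \<bar>w n\<bar> / ereal (ln (real n)))
      \<le> limsup (\<lambda>n. ereal ((ln K + ln \<beta>) / ln (real n) + ln \<beta> / ln r))"
    by (rule Limsup_mono)
  also have "\<dots> = ereal (ln \<beta> / ln r)"
  proof (rule lim_imp_Limsup)
    have "(\<lambda>n. (ln K + ln \<beta>) / ln (real n) + ln \<beta> / ln r) \<longlonglongrightarrow> ln \<beta> / ln r"
      by real_asymp
    then show "(\<lambda>n. ereal ((ln K + ln \<beta>) / ln (real n) + ln \<beta> / ln r)) \<longlonglongrightarrow> ereal (ln \<beta> / ln r)"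
      by simp
  qed simp
  finally show ?thesis .
qed

theorem theorem1p11:
  fixes q :: nat and \<pi> :: "nat \<Rightarrow> nat" and lam0 :: real and eigs :: "complex list"
  assumes "q > 0" and "\<not> (\<exists>n::nat. q = 2 ^ n)"
    and "\<pi> permutes {0..<q}"
    and "stationary q \<pi>"
    and "ergodic Leb (rotated_odometer q \<pi>)"
    and "char_poly (subst_matrix q \<pi>) = (\<Prod>\<mu>\<leftarrow>eigs. [:- \<mu>, 1:])"
    and "sorted_wrt (\<lambda>\<mu> \<nu>. cmod \<mu> \<ge> cmod \<nu>) eigs"
    and "eigs ! 0 = complex_of_real lam0" and "lam0 \<ge> cmod (eigs ! 1)"
    and "diagonalizable (subst_matrix q \<pi>)"
    and "order (complex_of_real lam0) (char_poly (subst_matrix q \<pi>)) = 1"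
    and "cmod (eigs ! 1) > 1"
  shows "AE x in Leb. \<forall>k. diffusion_coeff q \<pi> k x \<le> ereal (ln (cmod (eigs ! 1)) / ln lam0)"
proof -
  interpret odometer q \<pi> using assms(1,3) by unfold_locales
  let ?\<beta> = "cmod (eigs ! 1)"
  note st = assms(4)
  have cov: "covers k" for k by (rule covers_all[OF assms(4,5)])
  have d2: "2 \<le> d" using assms(1) unfolding alphabet_size_def by (auto elim!: evenE)
  have entry: "subst_matrix q \<pi> $$ (a, b) = complex_of_real (real (count_list (E (undouble q a)) b))"
    if "a < d" "b < d" for a b
    using that unfolding subst_matrix_def by (simp add: doubled_subst_eq)
  have lam: "lam0 = 2 ^ N \<and> (\<exists>C. \<forall>k. \<forall>a<d. cmod (complex_of_real (vec_it k a)) \<le> C * ?\<beta> ^ k)"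
  proof (intro conjI)
    have A: "subst_matrix q \<pi> \<in> carrier_mat d d" unfolding subst_matrix_def by simp
    have u0: "(\<Sum>a<d. complex_of_real (letter_weight a) * complex_of_real (vec_it 0 a)) = 0"
      unfolding of_real_mult[symmetric] of_real_sum[symmetric] letter_weight_skew by simp
    have u: "complex_of_real (vec_it (Suc k) a) =
        (\<Sum>b<d. subst_matrix q \<pi> $$ (a, b) * complex_of_real (vec_it k b))" if "a < d" for k a
      using that by (simp add: entry)
    note * = diagonalizable_nonneg_growth[OF A d2 entry _ letter_weight_pos letter_weight_eigen[OF cov] _
        assms(6-11), where u = "\<lambda>k a. complex_of_real (vec_it k a)", OF _ _ _ _ _ u0 u]
    show "lam0 = 2 ^ N" by (rule *(1)) auto
    show "\<exists>C. \<forall>k. \<forall>a<d. cmod (complex_of_real (vec_it k a)) \<le> C * ?\<beta> ^ k"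
      by (rule *(2)) auto
  qed
  then obtain C where C: "\<And>k a. a < d \<Longrightarrow> \<bar>vec_it k a\<bar> \<le> C * ?\<beta> ^ k" by auto
  have bs: "\<bar>block_sum k x\<bar> \<le> C * ?\<beta> ^ k" if x: "x \<in> L k" for k x
  proof (cases k)
    case 0
    then have x0: "x \<in> {0..<1}" using x level_0 by simp
    have "cl 1 x \<in> A" using x level_eq_Suc[of 0] 0 by simp
    then show ?thesis unfolding 0 block_sum_0[OF x0] by (intro C dbl_less)
  next
    case (Suc m)
    have "cl (Suc m) x < q" using x unfolding Suc level_eq by simp
    then obtain a where a: "a < d" "undouble q a = cl (Suc m) x" using undouble_surj by blast
    then show ?thesis unfolding Suc block_sum_eq[OF st x[unfolded Suc] a(2)] by (intro C)
  qed
  have C0: "0 \<le> C" using C[of 0 0] d2 by simp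
  \<comment> \<open>From summing the geometric series in \<open>seg\<close>; this is where
    \<open>?\<beta> > 1\<close> makes the deepest level dominate.\<close>
  let ?K = "2 * (real Tmax * (C / (?\<beta> - 1)))"
  have W: "\<bar>W n x\<bar> \<le> ?K * ?\<beta> ^ k" if x: "x \<in> {0..<1}" "\<And>t. t \<le> n \<Longrightarrow> (F ^^ t) x \<notin> L k" for n k x
  proof -
    have "\<bar>W n x\<bar> \<le> 2 * seg (\<lambda>j. C * ?\<beta> ^ j) k"
      by (rule segment_bound[OF st cov]) (use bs x in auto)
    also have "seg (\<lambda>j. C * ?\<beta> ^ j) k = real Tmax * (\<Sum>j<k. C * ?\<beta> ^ j)"
      by (rule seg_def) (use st cov bs in auto)
    also have "(\<Sum>j<k. C * ?\<beta> ^ j) = C * ((?\<beta> ^ k - 1) / (?\<beta> - 1))"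
      unfolding sum_distrib_left[symmetric] using assms(12) by (subst geometric_sum) auto
    also have "\<dots> \<le> C * (?\<beta> ^ k / (?\<beta> - 1))"
      using C0 assms(12) by (intro mult_left_mono divide_right_mono) auto
    finally show ?thesis by (simp add: mult_left_mono)
  qed
  have lam0: "lam0 = 2 ^ N" and lam1: "1 < lam0" using lam assms(9,12) by auto
  \<comment> \<open>A sequence of exponents below 1 tending to 1. Countably many suffice, so the
    exceptional null sets can be united before the limit is taken.\<close>
  define s where "s m = 1 - 1 / (real m + 2)" for m :: nat
  define r where "r m = lam0 powr s m" for m
  have s: "0 < s m" "s m < 1" for m unfolding s_def by (auto simp: field_simps)
  have r: "1 < r m" "r m < 2 ^ N" for m
    unfolding r_def lam0[symmetric] using lam1 s[of m] powr_less_mono[of "s m" 1 lam0] by (auto simp: gr_one_powr)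
  have "AE x in lborel. \<forall>m. x \<in> {0..<1} \<longrightarrow>
      (\<forall>\<^sub>F k in sequentially. \<forall>t. real t \<le> r m ^ k \<longrightarrow> (F ^^ t) x \<notin> L k)"
    unfolding AE_all_countable using AE_late_visits[OF r] by blast
  then have "AE x in lborel. x \<in> {0..<1} \<longrightarrow> (\<forall>k. diffusion_coeff q \<pi> k x \<le> ereal (ln ?\<beta> / ln lam0))"
  proof eventually_elim
    case (elim x)
    show ?case
    proof (intro impI allI)
      fix k assume x: "x \<in> {0..<1}"
      have eq: "\<bar>real_of_int (snd ((extension q \<pi> ^^ n) (x, k)) - k)\<bar> = \<bar>W n x\<bar>" for n
        unfolding extension_funpow by (simp add: bsum_def)
      have le: "diffusion_coeff q \<pi> k x \<le> ereal (ln ?\<beta> / ln (r m))" for m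
        unfolding diffusion_coeff_def eq
      proof (rule limsup_elog_le[OF assms(12) r(1)])
        have "\<forall>\<^sub>F k in sequentially. \<forall>t. real t \<le> r m ^ k \<longrightarrow> (F ^^ t) x \<notin> L k" using elim x by blast
        then show "\<forall>\<^sub>F k in sequentially. \<forall>n. real n \<le> r m ^ k \<longrightarrow> \<bar>W n x\<bar> \<le> ?K * ?\<beta> ^ k"
        proof eventually_elim
          case (elim k)
          show ?case
          proof (intro allI impI W[OF x])
            fix n t assume "real n \<le> r m ^ k" "t \<le> n"
            then show "(F ^^ t) x \<notin> L k" using elim by (meson of_nat_le_iff order_trans)
          qed
        qed
      qed
      have lim: "(\<lambda>m. ereal (ln ?\<beta> / ln (r m))) \<longlonglongrightarrow> ereal (ln ?\<beta> / ln lam0)"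
      proof -
        have "s \<longlonglongrightarrow> 1" unfolding s_def by real_asymp
        then have "(\<lambda>m. ln ?\<beta> / (s m * ln lam0)) \<longlonglongrightarrow> ln ?\<beta> / (1 * ln lam0)"
          using lam1 by (intro tendsto_intros) auto
        moreover have "ln (r m) = s m * ln lam0" for m unfolding r_def using lam1 by (simp add: ln_powr)
        ultimately show ?thesis by simp
      qed
      show "diffusion_coeff q \<pi> k x \<le> ereal (ln ?\<beta> / ln lam0)"
        by (rule tendsto_lowerbound[OF lim always_eventually trivial_limit_sequentially]) (rule allI, rule le)
    qed
  qed
  then show ?thesis unfolding Leb_def by (subst AE_restrict_space_iff) auto
qed

end
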